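(* Let $w(z)=K_{\alpha,\beta}[f](z)$ be an $(\alpha,\beta)$-harmonic function defined on $\mathbb{D}$, where $\alpha,\beta\in\mathbb{C}\setminus\mathbb{Z}^-$ and $\operatorname{Re}(\alpha+\beta)>-1$, with $f\in L^p(\mathbb{T})$, $1\le p<\infty$, and let $z=re^{i\theta}\in\mathbb{D}$. Let $q$ be the conjugate exponent of $p$, $\frac1p+\frac1q=1$, and put $$F_1=\left(F\left(1-\frac{(\operatorname{Re}(\alpha+\beta)+2)q}{2},1-\frac{(\operatorname{Re}(\alpha+\beta)+2)q}{2};1;r^2\right)\right)^{1/q}.$$ Then: (i) there exist a function $C_{\alpha,\beta,p}(r)$ and a constant $C_{\alpha,\beta,p}$ such that $$\left|\frac{\partial}{\partial z}w(z)\right|\le\frac{C_{\alpha,\beta,p}(r)}{(1-r^2)^{1+1/p}}\exp\left(\frac\pi2|\operatorname{Im}(\alpha-\beta)|\right)\|f\|_{L^p(\mathbb{T})}\le\frac{C_{\alpha,\beta,p}}{(1-r^2)^{1+1/p}}\exp\left(\frac\pi2|\operatorname{Im}(\alpha-\beta)|\right)\|f\|_{L^p(\mathbb{T})},$$ where $$C_{\alpha,\beta,p}(r)=|c_{\alpha,\beta}|(|\alpha+1|+|\beta|r)F_1,\qquad C_{\alpha,\beta,p}=|c_{\alpha,\beta}|(|\alpha+1|+|\beta|)\left(\frac{\Gamma((\operatorname{Re}(\alpha+\beta)+2)q-1)}{\Gamma^2\left(\frac{(\operatorname{Re}(\alpha+\beta)+2)q}{2}\right)}\right)^{1/q}.$$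 The constant $C_{\alpha,\beta,p}$ is asymptotically sharp as $\alpha,\beta\to0$. (ii) there exist a function $D_{\alpha,\beta,p}(r)$ and a constant $D_{\alpha,\beta,p}$ such that $$\left|\frac{\partial}{\partial\bar z}w(z)\right|\le\frac{D_{\alpha,\beta,p}(r)}{(1-r^2)^{1+1/p}}\exp\left(\frac\pi2|\operatorname{Im}(\alpha-\beta)|\right)\|f\|_{L^p(\mathbb{T})}\le\frac{D_{\alpha,\beta,p}}{(1-r^2)^{1+1/p}}\exp\left(\frac\pi2|\operatorname{Im}(\alpha-\beta)|\right)\|f\|_{L^p(\mathbb{T})},$$ where $$D_{\alpha,\beta,p}(r)=|c_{\alpha,\beta}|(|\beta+1|+|\alpha|r)F_1,\qquad D_{\alpha,\beta,p}=|c_{\alpha,\beta}|(|\beta+1|+|\alpha|)\left(\frac{\Gamma((\operatorname{Re}(\alpha+\beta)+2)q-1)}{\Gamma^2\left(\frac{(\operatorname{Re}(\alpha+\beta)+2)q}{2}\right)}\right)^{1/q}.$$ The constant $D_{\alpha,\beta,p}$ is asymptotically sharp as $\alpha,\beta\to0$.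
   Context: $\mathbb{D}=\{z\in\mathbb{C}:|z|<1\}$, $\mathbb{T}=\{z\in\mathbb{C}:|z|=1\}$, and $\mathbb{Z}^-$ is the set of negative integers. $\frac{\partial}{\partial z}=\frac12(\partial_x-i\partial_y)$, $\frac{\partial}{\partial\bar z}=\frac12(\partial_x+i\partial_y)$. A $C^2$ function $w:\mathbb{D}\to\mathbb{C}$ is $(\alpha,\beta)$-harmonic if $(1-|z|^2)\partial_z\partial_{\bar z}w+\alpha z\partial_zw+\beta\bar z\partial_{\bar z}w-\alpha\beta w=0$ in $\mathbb{D}$. Set $c_{\alpha,\beta}=\dfrac{\Gamma(\alpha+1)\Gamma(\beta+1)}{\Gamma(\alpha+\beta+1)}$, $$K_{\alpha,\beta}(z)=c_{\alpha,\beta}\frac{(1-|z|^2)^{\alpha+\beta+1}}{(1-z)^{\alpha+1}(1-\bar z)^{\beta+1}}\quad(z\in\mathbb{D}),\qquad K_{\alpha,\beta}[f](z)=\frac1{2\pi}\int_0^{2\pi}K_{\alpha,\beta}(ze^{-it})f(e^{it})\,dt .$$ $\|f\|_{L^p(\mathbb{T})}=\left(\frac1{2\pi}\int_0^{2\pi}|f(e^{i\theta})|^p\,d\theta\right)^{1/p}$. $\Gamma$ is the Gamma function and $F(a,b;c;x)=\sum_{n\ge0}\frac{(a)_n(b)_n}{(c)_n}\frac{x^n}{n!}$ is the Gauss hypergeometric function, with $(a)_0=1$, $(a)_n=a(a+1)\cdots(a+n-1)$. For $p=1$, i.e. $q=\infty$, the expressions involving $q$ are to be read as limits as $q\to\infty$.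 *)

theory Defs
  imports "HOL-Analysis.Analysis"
begin

definition pd_x :: "(complex \<Rightarrow> complex) \<Rightarrow> complex \<Rightarrow> complex" where
  "pd_x w z = vector_derivative (\<lambda>t::real. w (z + of_real t)) (at 0)"

definition pd_y :: "(complex \<Rightarrow> complex) \<Rightarrow> complex \<Rightarrow> complex" where
  "pd_y w z = vector_derivative (\<lambda>t::real. w (z + \<i> * of_real t)) (at 0)"

definition wirtinger :: "(complex \<Rightarrow> complex) \<Rightarrow> complex \<Rightarrow> complex" where
  "wirtinger w z = (pd_x w z - \<i> * pd_y w z) / 2"

definition wirtinger_bar :: "(complex \<Rightarrow> complex) \<Rightarrow> complex \<Rightarrow> complex" where
  "wirtinger_bar w z = (pd_x w z + \<i> * pd_y w z) / 2"

definition C1_on :: "complex set \<Rightarrow> (complex \<Rightarrow> complex) \<Rightarrow> bool" where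
  "C1_on S w \<longleftrightarrow>
     (\<forall>z\<in>S. (\<lambda>t::real. w (z + of_real t)) differentiable (at 0) \<and>
            (\<lambda>t::real. w (z + \<i> * of_real t)) differentiable (at 0)) \<and>
     continuous_on S (pd_x w) \<and> continuous_on S (pd_y w)"

definition C2_on :: "complex set \<Rightarrow> (complex \<Rightarrow> complex) \<Rightarrow> bool" where
  "C2_on S w \<longleftrightarrow> C1_on S w \<and> C1_on S (pd_x w) \<and> C1_on S (pd_y w)"

definition ab_harmonic :: "complex \<Rightarrow> complex \<Rightarrow> (complex \<Rightarrow> complex) \<Rightarrow> bool" where
  "ab_harmonic \<alpha> \<beta> w \<longleftrightarrow> C2_on (ball 0 1) w \<and>
     (\<forall>z\<in>ball 0 1. of_real (1 - (cmod z)\<^sup>2) * wirtinger (wirtinger_bar w) z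
        + \<alpha> * z * wirtinger w z + \<beta> * cnj z * wirtinger_bar w z - \<alpha> * \<beta> * w z = 0)"

definition c_ab :: "complex \<Rightarrow> complex \<Rightarrow> complex" where
  "c_ab \<alpha> \<beta> = Gamma (\<alpha> + 1) * Gamma (\<beta> + 1) / Gamma (\<alpha> + \<beta> + 1)"

definition K_kernel :: "complex \<Rightarrow> complex \<Rightarrow> complex \<Rightarrow> complex" where
  "K_kernel \<alpha> \<beta> z = c_ab \<alpha> \<beta> * of_real (1 - (cmod z)\<^sup>2) powr (\<alpha> + \<beta> + 1)
     / ((1 - z) powr (\<alpha> + 1) * (1 - cnj z) powr (\<beta> + 1))"

definition K_int :: "complex \<Rightarrow> complex \<Rightarrow> (complex \<Rightarrow> complex) \<Rightarrow> complex \<Rightarrow> complex" where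
  "K_int \<alpha> \<beta> f z = of_real (1 / (2 * pi)) *
     (LINT t|lebesgue_on {0..2 * pi}. K_kernel \<alpha> \<beta> (z * cis (- t)) * f (cis t))"

(* Only the values of f on the unit circle matter. *)
definition Lp_circle :: "real \<Rightarrow> (complex \<Rightarrow> complex) set" where
  "Lp_circle p = {f. (\<lambda>t. f (cis t)) \<in> borel_measurable (lebesgue_on {0..2 * pi}) \<and>
                     integrable (lebesgue_on {0..2 * pi}) (\<lambda>t. cmod (f (cis t)) powr p)}"

definition Lp_norm :: "real \<Rightarrow> (complex \<Rightarrow> complex) \<Rightarrow> real" where
  "Lp_norm p f =
     (1 / (2 * pi) * (LINT t|lebesgue_on {0..2 * pi}. cmod (f (cis t)) powr p)) powr (1 / p)"

definition hypergeo :: "real \<Rightarrow> real \<Rightarrow> real \<Rightarrow> real \<Rightarrow> real" where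
  "hypergeo a b c x =
     (\<Sum>n. pochhammer a n * pochhammer b n / pochhammer c n * (x ^ n / fact n))"

(* The value of G at the conjugate exponent q of p, 1/p + 1/q = 1;
   for p = 1, i.e. q = infinity, this is the limit of G q as q tends to infinity. *)
definition at_conjugate :: "real \<Rightarrow> (real \<Rightarrow> real) \<Rightarrow> real" where
  "at_conjugate p G = (if p = 1 then Lim at_top G else G (p / (p - 1)))"

definition F1 :: "complex \<Rightarrow> complex \<Rightarrow> real \<Rightarrow> real \<Rightarrow> real" where
  "F1 \<alpha> \<beta> p r = at_conjugate p (\<lambda>q.
     hypergeo (1 - (Re (\<alpha> + \<beta>) + 2) * q / 2) (1 - (Re (\<alpha> + \<beta>) + 2) * q / 2) 1 (r\<^sup>2)
       powr (1 / q))"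

definition Gamma_factor :: "complex \<Rightarrow> complex \<Rightarrow> real \<Rightarrow> real" where
  "Gamma_factor \<alpha> \<beta> p = at_conjugate p (\<lambda>q.
     (Gamma ((Re (\<alpha> + \<beta>) + 2) * q - 1) / (Gamma ((Re (\<alpha> + \<beta>) + 2) * q / 2))\<^sup>2)
       powr (1 / q))"

definition C_fun :: "complex \<Rightarrow> complex \<Rightarrow> real \<Rightarrow> real \<Rightarrow> real" where
  "C_fun \<alpha> \<beta> p r = cmod (c_ab \<alpha> \<beta>) * (cmod (\<alpha> + 1) + cmod \<beta> * r) * F1 \<alpha> \<beta> p r"

definition C_const :: "real \<Rightarrow> complex \<Rightarrow> complex \<Rightarrow> real" where
  "C_const p \<alpha> \<beta> = cmod (c_ab \<alpha> \<beta>) * (cmod (\<alpha> + 1) + cmod \<beta>) * Gamma_factor \<alpha> \<beta> p"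

definition D_fun :: "complex \<Rightarrow> complex \<Rightarrow> real \<Rightarrow> real \<Rightarrow> real" where
  "D_fun \<alpha> \<beta> p r = cmod (c_ab \<alpha> \<beta>) * (cmod (\<beta> + 1) + cmod \<alpha> * r) * F1 \<alpha> \<beta> p r"

definition D_const :: "real \<Rightarrow> complex \<Rightarrow> complex \<Rightarrow> real" where
  "D_const p \<alpha> \<beta> = cmod (c_ab \<alpha> \<beta>) * (cmod (\<beta> + 1) + cmod \<alpha>) * Gamma_factor \<alpha> \<beta> p"

definition growth_bound ::
    "real \<Rightarrow> complex \<Rightarrow> complex \<Rightarrow> (complex \<Rightarrow> complex) \<Rightarrow> real \<Rightarrow> real \<Rightarrow> real" where
  "growth_bound p \<alpha> \<beta> f r C =
     C / (1 - r\<^sup>2) powr (1 + 1 / p) * exp (pi / 2 * \<bar>Im (\<alpha> - \<beta>)\<bar>) * Lp_norm p f"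

(* The smallest constant for which the growth estimate holds for the derivatives, given by the
   operator T (one of the two Wirtinger derivatives), of all K_int \<alpha> \<beta> f with f in L^p. *)
definition best_const ::
    "((complex \<Rightarrow> complex) \<Rightarrow> complex \<Rightarrow> complex) \<Rightarrow> real \<Rightarrow> complex \<Rightarrow> complex \<Rightarrow> real" where
  "best_const T p \<alpha> \<beta> =
     Inf {C. \<forall>f\<in>Lp_circle p. \<forall>z\<in>ball 0 1.
               cmod (T (K_int \<alpha> \<beta> f) z) \<le> growth_bound p \<alpha> \<beta> f (cmod z) C}"

(* C is a family of constants, B the family of best possible ones. The constants tend to the
   sharp constant of the harmonic case \<alpha> = \<beta> = 0, and their ratio to the best constant tends to 1.
   The filter nhds (rather than at) includes the point (0, 0) itself, where equality is
   thereby required. *)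
definition asymptotically_sharp ::
    "(complex \<Rightarrow> complex \<Rightarrow> real) \<Rightarrow> (complex \<Rightarrow> complex \<Rightarrow> real) \<Rightarrow> bool" where
  "asymptotically_sharp C B \<longleftrightarrow>
     ((\<lambda>(\<alpha>, \<beta>). C \<alpha> \<beta>) \<longlongrightarrow> B 0 0) (nhds (0, 0)) \<and>
     ((\<lambda>(\<alpha>, \<beta>). C \<alpha> \<beta> / B \<alpha> \<beta>) \<longlongrightarrow> 1) (nhds (0, 0))"

end

theory Submission
  imports Defs
begin

text \<open>Write \<open>s = Re (\<alpha> + \<beta>) + 2\<close>. Differentiating under the integral sign bounds the derivative of the kernel
  by a multiple of \<open>\<bar>1 - \<zeta>\<bar> powr (- s)\<close>, where \<open>\<zeta> = z cis (- t)\<close>, and the Hoelder inequality leads to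
  the mean of \<open>\<bar>1 - \<zeta>\<bar> powr (- s q)\<close> over the circle. The automorphism of the disc that takes \<open>0\<close> to \<open>r\<close> turns
  this mean into \<open>(1 - r\<^sup>2) powr (1 - s q)\<close> times the mean of \<open>\<bar>1 + r cis (- t)\<bar> powr (s q - 2)\<close>. By Parseval's
  identity the latter is the hypergeometric series in \<open>F1\<close>; its coefficients are nonnegative, so it
  increases with \<open>r\<close>, and its value at \<open>r = 1\<close> is a Beta integral equal to the Gamma quotient.

  At \<open>\<alpha> = \<beta> = 0\<close> the equality case of the Hoelder inequality shows that the constant is attained as
  \<open>r \<rightarrow> 1\<close>. Testing with these fixed functions shows that the best constant is lower semicontinuous at \<open>(0, 0)\<close>;
  it is bounded above by \<open>C_const\<close>, which is continuous there, so both tend to the same limit.\<close>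

section \<open>Parseval's identity and the hypergeometric series\<close>

text \<open>The exponent 1 + 1/p is free of the parameters because of a cancellation: the kernel
  derivative contributes the power s - 2 of 1 - r^2, the Hoelder inequality the power (1 - s q)/q =
  1 - 1/p - s.

  The binomial series behind the Parseval step is only available for r < 1, while the constant is
  the value at r = 1. The two are joined by dominated convergence, which is delicate when s q < 2:
  the exponent s q - 2 is then negative and the integrand blows up at one point of the circle.
  Integrability there amounts to s q > 1, guaranteed by Re (\<alpha> + \<beta>) > -1.

  The second obstacle is p = 1. There the L^q mean degenerates to a maximum, so \<open>F1\<close>
  and the Gamma quotient have to be evaluated as limits, (1 + r) powr s and 2 powr s. In the
  sharpness part near-extremal functions of a large finite exponent q are used, with r fixed before
  q.\<close>

definition circle_mean :: "(real \<Rightarrow> 'a::euclidean_space) \<Rightarrow> 'a" where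
  "circle_mean h = (1 / (2 * pi)) *\<^sub>R (LINT t|lebesgue_on {0..2 * pi}. h t)"

abbreviation circ :: "real measure" where "circ \<equiv> lebesgue_on {0..2 * pi}"

lemma integrable_circ_continuous:
  fixes h :: "real \<Rightarrow> 'a::euclidean_space"
  assumes "continuous_on {0..2 * pi} h"
  shows "integrable circ h"
  by (rule continuous_imp_integrable_real[OF assms])

lemma integral_circ_continuous:
  fixes h :: "real \<Rightarrow> 'a::euclidean_space"
  assumes "continuous_on {0..2 * pi} h"
  shows "(LINT t|circ. h t) = integral {0..2 * pi} h"
  by (intro lebesgue_integral_eq_integral integrable_circ_continuous assms) auto

lemma integrable_circ_mult:
  fixes f k :: "real \<Rightarrow> 'a::{euclidean_space, real_normed_algebra}"
  assumes k: "continuous_on {0..2 * pi} k" and f: "integrable circ f"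
  shows "integrable circ (\<lambda>t. k t * f t)"
proof -
  have "bounded (k ` {0..2*pi})"
    by (intro compact_imp_bounded compact_continuous_image k) auto
  then obtain B where B: "\<And>t. t \<in> {0..2*pi} \<Longrightarrow> norm (k t) \<le> B"
    unfolding bounded_iff by blast
  show ?thesis
  proof (rule Bochner_Integration.integrable_bound)
    show "integrable circ (\<lambda>t. B * norm (f t))" using f by simp
    show "(\<lambda>t. k t * f t) \<in> borel_measurable circ"
      using borel_measurable_integrable[OF integrable_circ_continuous[OF k]] f by simp
    show "AE t in circ. norm (k t * f t) \<le> norm (B * norm (f t))"
      using AE_space
    proof eventually_elim
      fix t assume "t \<in> space circ"
      hence "norm (k t) \<le> B" using B by simp
      moreover from this have "0 \<le> B" using norm_ge_zero order_trans by blast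
      ultimately show "norm (k t * f t) \<le> norm (B * norm (f t))"
        using norm_mult_ineq[of "k t" "f t"] by (simp add: mult_right_mono order_trans)
    qed
  qed
qed

lemma integral_circ_cis:
  "(LINT t|circ. cis (of_int k * t)) = (if k = 0 then of_real (2 * pi) else 0)"
proof -
  have c: "continuous_on {0..2*pi} (\<lambda>t. cis (of_int k * t))" by (intro continuous_intros)
  show ?thesis
  proof (cases "k = 0")
    case True
    thus ?thesis using integral_circ_continuous[OF c]
      by (simp add: scaleR_conv_of_real)
  next
    case False
    define F where "F = (\<lambda>z. exp (\<i> * of_int k * z) / (\<i> * of_int k))"
    have F: "(F has_field_derivative exp (\<i> * of_int k * z)) (at z)" for z
      unfolding F_def using False by (auto intro!: derivative_eq_intros)
    have "((\<lambda>t. cis (of_int k * t)) has_integral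
       (cis (of_int k * (2*pi)) / (\<i> * of_int k) - cis (of_int k * 0) / (\<i> * of_int k))) {0..2*pi}"
      using has_vector_derivative_real_field[OF F]
      by (intro fundamental_theorem_of_calculus)
         (auto simp: cis_conv_exp F_def mult_ac)
    moreover have "cis (of_int k * (2*pi)) = 1"
      using cis_multiple_2pi[of k] by (simp add: mult.commute)
    ultimately show ?thesis using integral_circ_continuous[OF c] False
      by (simp add: integral_unique)
  qed
qed

text \<open>The integral of the modulus of the n-th term is at most a constant times
  \<open>norm (a n)\<close>, so sum and integral may be exchanged. The factor \<open>h\<close>
  serves twice below: as \<open>cis (of_nat m * t)\<close> to extract a coefficient, and as the
  conjugate of the whole sum.\<close>

lemma integral_circ_fourier_series:
  fixes a :: "nat \<Rightarrow> complex"
  assumes a: "summable (\<lambda>n. norm (a n))" and h: "continuous_on {0..2 * pi} h"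
  shows "(\<lambda>n. LINT t|circ. a n * cis (- of_nat n * t) * h t) sums
           (LINT t|circ. (\<Sum>n. a n * cis (- of_nat n * t)) * h t)"
proof -
  have "bounded (h ` {0..2*pi})"
    by (intro compact_imp_bounded compact_continuous_image h) auto
  then obtain B where B: "\<And>t. t \<in> {0..2*pi} \<Longrightarrow> norm (h t) \<le> B"
    unfolding bounded_iff by blast
  have int: "integrable circ (\<lambda>t. a n * cis (- of_nat n * t) * h t)" for n
    by (intro integrable_circ_continuous continuous_intros h)
  have "(\<lambda>n. LINT t|circ. a n * cis (- of_nat n * t) * h t) sums
          (LINT t|circ. (\<Sum>n. a n * cis (- of_nat n * t) * h t))"
  proof (rule sums_integral)
    show "AE t in circ. summable (\<lambda>n. norm (a n * cis (- of_nat n * t) * h t))"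
      using a by (simp add: norm_mult summable_mult2)
    show "summable (\<lambda>n. LINT t|circ. norm (a n * cis (- of_nat n * t) * h t))"
    proof (rule summable_comparison_test')
      show "summable (\<lambda>n. norm (a n) * (2 * pi * B))" using a by (rule summable_mult2)
      fix n
      have "(LINT t|circ. norm (a n * cis (- of_nat n * t) * h t)) \<le> (LINT t|circ. norm (a n) * B)"
        using int[of n] B by (intro integral_mono)
          (auto simp: norm_mult intro!: mult_left_mono integrable_circ_continuous continuous_intros h)
      also have "\<dots> = norm (a n) * (2 * pi * B)"
        by (subst integral_circ_continuous) auto
      finally show "norm (LINT t|circ. norm (a n * cis (- of_nat n * t) * h t)) \<le> norm (a n) * (2 * pi * B)"
        by simp
    qed
  qed (rule int)
  moreover have "summable (\<lambda>n. a n * cis (- of_nat n * t))" for t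
    by (rule summable_norm_cancel) (use a in \<open>simp add: norm_mult\<close>)
  hence "(\<Sum>n. a n * cis (- of_nat n * t) * h t) = (\<Sum>n. a n * cis (- of_nat n * t)) * h t" for t
    by (rule suminf_mult2[symmetric])
  ultimately show ?thesis by (simp only:)
qed

text \<open>The Weierstrass M-test makes the sum \<open>g\<close> continuous. In the integral of g *
  cnj g the series is inserted for the first factor only; each term is then a n times the conjugate
  of a Fourier coefficient of \<open>g\<close>, which is 2 pi * a n.\<close>

lemma parseval_circle:
  fixes a :: "nat \<Rightarrow> complex"
  assumes a: "summable (\<lambda>n. norm (a n))"
  shows "(\<lambda>n. (norm (a n))\<^sup>2) sums circle_mean (\<lambda>t. (norm (\<Sum>n. a n * cis (- of_nat n * t)))\<^sup>2)"
proof -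
  define g where "g t = (\<Sum>n. a n * cis (- of_nat n * t))" for t
  have g: "continuous_on {0..2*pi} g" unfolding g_def
  proof (rule uniform_limit_theorem)
    show "uniform_limit {0..2*pi} (\<lambda>m t. \<Sum>n<m. a n * cis (- of_nat n * t))
            (\<lambda>t. \<Sum>n. a n * cis (- of_nat n * t)) sequentially"
      by (rule Weierstrass_m_test[OF _ a]) (simp add: norm_mult)
  qed (auto intro!: always_eventually continuous_intros)
  have coef: "(LINT t|circ. g t * cis (of_nat m * t)) = of_real (2 * pi) * a m" for m
  proof -
    have "(\<lambda>n. LINT t|circ. a n * cis (- of_nat n * t) * cis (of_nat m * t)) sums
            (LINT t|circ. g t * cis (of_nat m * t))"
      unfolding g_def by (intro integral_circ_fourier_series a continuous_intros)
    moreover have "(LINT t|circ. a n * cis (- of_nat n * t) * cis (of_nat m * t)) =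
        (if n = m then of_real (2 * pi) * a m else 0)" for n
    proof -
      have "(LINT t|circ. a n * cis (- of_nat n * t) * cis (of_nat m * t)) =
            (LINT t|circ. a n * cis (of_int (int m - int n) * t))"
        by (intro Bochner_Integration.integral_cong) (simp_all add: mult.assoc cis_mult algebra_simps)
      also have "\<dots> = a n * (LINT t|circ. cis (of_int (int m - int n) * t))"
        by (rule integral_mult_right_zero)
      finally show ?thesis unfolding integral_circ_cis by simp
    qed
    moreover have "(\<lambda>n. if n = m then of_real (2 * pi) * a m else 0) sums (of_real (2*pi) * a m)"
      using sums_single[of m "\<lambda>_. of_real (2*pi) * a m"] by simp
    ultimately show ?thesis using sums_unique2 by simp
  qed
  have "(\<lambda>n. LINT t|circ. a n * cis (- of_nat n * t) * cnj (g t)) sums (LINT t|circ. g t * cnj (g t))"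
    using integral_circ_fourier_series[OF a continuous_on_cnj[OF g]]
    by (simp only: g_def[symmetric])
  moreover have "(LINT t|circ. a n * cis (- of_nat n * t) * cnj (g t)) = of_real (2 * pi * (norm (a n))\<^sup>2)" for n
  proof -
    have "(LINT t|circ. a n * cis (- of_nat n * t) * cnj (g t)) =
          a n * (LINT t|circ. cnj (g t * cis (of_nat n * t)))"
      by (subst integral_mult_right_zero[symmetric], intro Bochner_Integration.integral_cong)
         (simp_all add: cis_cnj mult_ac)
    also have "\<dots> = a n * cnj (of_real (2*pi) * a n)"
      by (subst Bochner_Integration.integral_cnj) (simp add: coef)
    finally show ?thesis
      by (simp only: of_real_mult complex_norm_square) (simp add: mult_ac)
  qed
  moreover have "(LINT t|circ. g t * cnj (g t)) = of_real (LINT t|circ. (norm (g t))\<^sup>2)"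
    by (subst integral_complex_of_real[symmetric])
       (intro Bochner_Integration.integral_cong, simp_all add: complex_norm_square del: of_real_power)
  ultimately have "(\<lambda>n. of_real (2 * pi * (norm (a n))\<^sup>2) :: complex) sums of_real (LINT t|circ. (norm (g t))\<^sup>2)"
    by simp
  hence "(\<lambda>n. 2 * pi * (norm (a n))\<^sup>2) sums (LINT t|circ. (norm (g t))\<^sup>2)"
    by (subst (asm) sums_of_real_iff)
  from sums_mult[OF this, of "1 / (2*pi)"] show ?thesis
    by (simp add: circle_mean_def g_def)
qed

text \<open>Parseval applied to the binomial series of (1 + z cis(-t)) powr (-a), whose coefficients
  have modulus |(a)_n| / n!. The lower parameter 1 contributes (1)_n = n!, which makes the
  hypergeometric coefficient a perfect square.\<close>

lemma hypergeo_eq_circle_mean: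
  assumes "norm z < 1"
  shows "(\<lambda>n. (pochhammer a n)\<^sup>2 / (fact n)\<^sup>2 * ((norm z)\<^sup>2) ^ n) sums
           circle_mean (\<lambda>t. norm (1 + z * cis (- t)) powr (- 2 * a))"
    and "hypergeo a a 1 ((norm z)\<^sup>2) = circle_mean (\<lambda>t. norm (1 + z * cis (- t)) powr (- 2 * a))"
proof -
  define b where "b n = (complex_of_real (- a) gchoose n) * z ^ n" for n
  have "summable (\<lambda>n. norm (b n))" unfolding b_def
  proof (rule powser_insidea)
    \<comment> \<open>A radius strictly between |z| and 1: the series converges at \<open>K\<close>,
      hence absolutely at \<open>z\<close>.\<close>
    define K where "K = (1 + norm z) / 2"
    have K: "norm z < K" "K < 1" "K > 0" using assms by (auto simp: K_def add_pos_nonneg)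
    show "summable (\<lambda>n. (complex_of_real (-a) gchoose n) * (of_real K) ^ n)"
      using gen_binomial_complex[of "of_real K"] K by (auto simp: sums_iff)
    show "norm z < norm (complex_of_real K)" using K by simp
  qed
  note P = parseval_circle[OF this]
  have "(norm (b n))\<^sup>2 = (pochhammer a n)\<^sup>2 / (fact n)\<^sup>2 * ((norm z)\<^sup>2) ^ n" for n
  proof -
    have "norm (complex_of_real (- a) gchoose n) = \<bar>pochhammer a n / fact n\<bar>"
      by (simp add: gbinomial_pochhammer norm_mult norm_divide norm_power pochhammer_of_real flip: of_real_minus)
    thus ?thesis
      by (simp add: b_def norm_mult norm_power power_mult_distrib power_divide
               flip: power_mult) (simp add: power_mult mult.commute)
  qed
  moreover have "(norm (\<Sum>n. b n * cis (- of_nat n * t)))\<^sup>2 = norm (1 + z * cis (- t)) powr (- 2 * a)" for t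
  proof -
    have "b n * cis (- of_nat n * t) = (complex_of_real (- a) gchoose n) * (z * cis (- t)) ^ n" for n
      by (simp add: b_def power_mult_distrib Complex.DeMoivre mult_ac)
    hence "(\<lambda>n. b n * cis (- of_nat n * t)) sums (1 + z * cis (- t)) powr (of_real (- a))"
      using gen_binomial_complex[of "z * cis (-t)" "of_real (- a)"] assms by (simp add: norm_mult)
    hence "norm (\<Sum>n. b n * cis (- of_nat n * t)) = norm (1 + z * cis (- t)) powr (- a)"
      by (simp add: sums_iff norm_powr_real_powr')
    thus ?thesis by (simp add: power2_eq_square powr_add[symmetric])
  qed
  ultimately show *: "(\<lambda>n. (pochhammer a n)\<^sup>2 / (fact n)\<^sup>2 * ((norm z)\<^sup>2) ^ n) sums
           circle_mean (\<lambda>t. norm (1 + z * cis (- t)) powr (- 2 * a))"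
    using P by simp
  have "hypergeo a a 1 ((norm z)\<^sup>2) = (\<Sum>n. (pochhammer a n)\<^sup>2 / (fact n)\<^sup>2 * ((norm z)\<^sup>2) ^ n)"
    unfolding hypergeo_def by (simp add: pochhammer_fact[symmetric] power2_eq_square)
  with * show "hypergeo a a 1 ((norm z)\<^sup>2) = circle_mean (\<lambda>t. norm (1 + z * cis (- t)) powr (- 2 * a))"
    by (simp add: sums_iff)
qed

section \<open>The Beta integral and the disc automorphism\<close>

lemma norm_one_plus_ge:
  assumes "0 \<le> r"
  shows "1 + r * cos t \<le> norm (1 + of_real r * cis (- t))"
  using complex_Re_le_cmod[of "1 + of_real r * cis (- t)"] by simp

lemma norm_one_plus_sq:
  "(norm (1 + complex_of_real r * cis (- t)))\<^sup>2 = 1 + 2 * r * cos t + r\<^sup>2"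
proof -
  have "(norm (1 + complex_of_real r * cis (- t)))\<^sup>2 = (1 + r * cos t)\<^sup>2 + (r * sin t)\<^sup>2"
    by (simp add: cmod_power2)
  also have "\<dots> = 1 + 2 * r * cos t + r\<^sup>2 * ((cos t)\<^sup>2 + (sin t)\<^sup>2)"
    by (simp only: power2_eq_square distrib_left) (simp add: algebra_simps)
  finally show ?thesis by simp
qed

lemma norm_one_plus_cis: "norm (1 + cis (- t)) = 2 * \<bar>cos (t / 2)\<bar>"
proof (rule power2_eq_imp_eq)
  have "(cos (t/2))\<^sup>2 = (1 + cos t) / 2" using cos_double_cos[of "t/2"] by simp
  thus "(norm (1 + cis (- t)))\<^sup>2 = (2 * \<bar>cos (t / 2)\<bar>)\<^sup>2"
    using norm_one_plus_sq[of 1 t] by (simp add: power_mult_distrib)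
qed auto

text \<open>The substitution x = cos^2(t/2) turns the Beta integrand into the power of the cosine.
  It is injective on a half circle, not on the whole one. The condition on c is integrability at t =
  pi.\<close>

lemma integral_powr_cos:
  fixes c :: real
  assumes c: "c > -1"
  shows "(\<lambda>t. \<bar>cos (t / 2)\<bar> powr c) absolutely_integrable_on {0..pi}"
    and "integral {0..pi} (\<lambda>t. \<bar>cos (t / 2)\<bar> powr c) = Beta ((c + 1) / 2) (1 / 2)"
proof -
  let ?f = "\<lambda>x::real. x powr ((c + 1) / 2 - 1) * (1 - x) powr (1 / 2 - 1)"
  let ?g = "\<lambda>t::real. (cos (t / 2))\<^sup>2"
  let ?g' = "\<lambda>t::real. - (cos (t / 2) * sin (t / 2))"
  have cos0: "cos (t / 2) \<ge> 0" if "t \<in> {0..pi}" for t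
    using that by (intro cos_ge_zero) auto
  have sin0: "sin (t / 2) \<ge> 0" if "t \<in> {0..pi}" for t
    using that by (intro sin_ge_zero) auto
  have inj: "inj_on ?g {0..pi}"
  proof (rule inj_onI)
    fix x y assume xy: "x \<in> {0..pi}" "y \<in> {0..pi}" "?g x = ?g y"
    hence c: "cos (x / 2) = cos (y / 2)" using power2_eq_imp_eq[OF xy(3) cos0 cos0] by simp
    have "x / 2 = y / 2" by (rule cos_inj_pi[OF _ _ _ _ c]) (use xy(1,2) in simp_all)
    thus "x = y" by simp
  qed
  have img: "?g ` {0..pi} = {0..1}"
  proof
    show "?g ` {0..pi} \<subseteq> {0..1}" by (auto simp: abs_square_le_1)
    show "{0..1} \<subseteq> ?g ` {0..pi}"
    proof
      fix x :: real assume x: "x \<in> {0..1}"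
      have "0 \<le> sqrt x" "sqrt x \<le> 1" using x by simp_all
      moreover from this have "-1 \<le> sqrt x" by linarith
      ultimately have "arccos (sqrt x) \<le> pi/2" "0 \<le> arccos (sqrt x)" "cos (arccos (sqrt x)) = sqrt x"
        using arccos_le_pi2[of "sqrt x"] arccos_lbound[of "sqrt x"] cos_arccos[of "sqrt x"] by auto
      moreover from this have "2 * arccos (sqrt x) \<le> pi" by linarith
      ultimately show "x \<in> ?g ` {0..pi}" using x by (intro image_eqI[of _ _ "2 * arccos (sqrt x)"]) auto
    qed
  qed
  have B: "(?f has_integral Beta ((c + 1) / 2) (1 / 2)) {0..1}"
    using has_integral_Beta_real[of "(c + 1) / 2" "1/2"] c by simp
  have "?f absolutely_integrable_on ?g ` {0..pi} \<and> integral (?g ` {0..pi}) ?f = Beta ((c + 1) / 2) (1 / 2)"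
    unfolding img using B
    by (auto simp: has_integral_iff intro!: nonnegative_absolutely_integrable_1)
  hence *: "(\<lambda>t. \<bar>?g' t\<bar> * ?f (?g t)) absolutely_integrable_on {0..pi} \<and>
     integral {0..pi} (\<lambda>t. \<bar>?g' t\<bar> * ?f (?g t)) = Beta ((c + 1) / 2) (1 / 2)"
    by (subst has_absolute_integral_change_of_variables_1'[OF _ _ inj])
       (auto intro!: derivative_eq_intros)
  \<comment> \<open>At t = 0 the sine makes the left side 0 while the right side is 1, so the end
    points are split off as a negligible set.\<close>
  have eq: "\<bar>?g' t\<bar> * ?f (?g t) = \<bar>cos (t / 2)\<bar> powr c" if "t \<in> {0..pi} - {0,pi}" for t
  proof -
    have t: "0 < cos (t / 2)" "0 < sin (t / 2)" using that by (auto intro!: cos_gt_zero sin_gt_zero)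
    have "1 - ?g t = (sin (t/2))\<^sup>2" by (simp add: sin_squared_eq)
    moreover have "((sin (t/2))\<^sup>2) powr (1/2 - 1) = inverse (sin (t / 2))"
      using t by (simp add: powr_minus powr_half_sqrt)
    moreover have "(?g t) powr ((c+1)/2 - 1) = cos (t/2) powr (c - 1)"
    proof -
      have "(?g t) powr ((c+1)/2 - 1) = cos (t/2) powr (2 * ((c+1)/2 - 1))"
        using t by (simp add: powr_powr flip: powr_numeral)
      also have "2 * ((c+1)/2 - 1) = c - 1" by simp
      finally show ?thesis .
    qed
    ultimately show ?thesis
      using t by (simp add: abs_mult powr_diff)
  qed
  have neg: "negligible {0, pi}" by simp
  show "(\<lambda>t. \<bar>cos (t / 2)\<bar> powr c) absolutely_integrable_on {0..pi}"
    by (rule absolutely_integrable_spike[OF conjunct1[OF *] neg]) (rule eq[symmetric])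
  have "integral {0..pi} (\<lambda>t. \<bar>cos (t / 2)\<bar> powr c) = integral {0..pi} (\<lambda>t. \<bar>?g' t\<bar> * ?f (?g t))"
    by (rule integral_spike[OF neg]) (rule eq)
  thus "integral {0..pi} (\<lambda>t. \<bar>cos (t / 2)\<bar> powr c) = Beta ((c + 1) / 2) (1 / 2)" using * by simp
qed

text \<open>Legendre's duplication formula at (c + 1)/2 trades Gamma((c + 1)/2) for Gamma(c + 1) /
  Gamma(c/2 + 1); the powers of 2 cancel, and its sqrt pi together with Gamma(1/2) cancels the pi.
  The formula is applied to the complex Gamma function, hence the passage through
  \<open>of_real\<close>.\<close>

lemma Beta_half_eq:
  fixes c :: real
  assumes "c > -1"
  shows "2 powr c * Beta ((c + 1) / 2) (1 / 2) / pi = Gamma (c + 1) / (Gamma (c / 2 + 1))\<^sup>2"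
proof -
  let ?z = "(c + 1) / 2"
  have z: "?z > 0" using assms by simp
  have "complex_of_real (Gamma ?z * Gamma (?z + 1/2)) = Gamma (of_real ?z) * Gamma (of_real ?z + 1/2)"
    by (simp add: Gamma_complex_of_real[symmetric])
  also have "\<dots> = exp ((1 - 2 * of_real ?z) * of_real (ln 2)) * of_real (sqrt pi) * Gamma (2 * of_real ?z)"
  proof (rule Gamma_legendre_duplication)
    show "complex_of_real ?z \<notin> \<int>\<^sub>\<le>\<^sub>0" using z by (simp only: of_real_in_nonpos_Ints_iff) (auto elim!: nonpos_Ints_cases)
    have "?z + 1/2 > 0" using z by linarith
    hence "complex_of_real (?z + 1/2) \<notin> \<int>\<^sub>\<le>\<^sub>0" by (simp only: of_real_in_nonpos_Ints_iff) (metis nonpos_Ints_nonpos not_le)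
    thus "complex_of_real ?z + 1/2 \<notin> \<int>\<^sub>\<le>\<^sub>0" by simp
  qed
  also have "2 * complex_of_real ?z = of_real (c + 1)" by (simp add: field_simps)
  also have "exp ((1 - of_real (c + 1)) * complex_of_real (ln 2)) * of_real (sqrt pi) * Gamma (of_real (c + 1))
      = complex_of_real (exp (- c * ln 2) * sqrt pi * Gamma (c + 1))"
    by (simp add: Gamma_complex_of_real[symmetric] exp_of_real[symmetric] add.commute)
  finally have "Gamma ?z * Gamma (?z + 1/2) = exp (- c * ln 2) * sqrt pi * Gamma (c + 1)"
    by (simp only: of_real_eq_iff)
  moreover have "?z + 1/2 = c / 2 + 1" by (simp add: field_simps)
  moreover have "exp (- c * ln 2) = 2 powr (-c)" by (simp add: powr_def)
  moreover have "Gamma (c / 2 + 1) > 0" using assms by (intro Gamma_real_pos) simp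
  ultimately have *: "Gamma ?z = 2 powr (- c) * sqrt pi * Gamma (c + 1) / Gamma (c / 2 + 1)"
    by (intro eq_divide_imp) (auto simp: mult_ac simp del: times_divide_eq_left)
  have "Beta ?z (1/2) = Gamma ?z * sqrt pi / Gamma (c / 2 + 1)"
    by (simp add: Beta_def Gamma_one_half_real \<open>?z + 1/2 = c / 2 + 1\<close>)
  also have "\<dots> = 2 powr (-c) * pi * Gamma (c + 1) / (Gamma (c / 2 + 1))\<^sup>2"
    unfolding * by (simp add: power2_eq_square)
  finally show ?thesis by (simp add: powr_minus)
qed

text \<open>The modulus 2 |cos(t/2)| is symmetric under t -> 2 pi - t, so each half circle
  contributes the same Beta integral.\<close>

lemma circle_mean_boundary:
  fixes c :: real
  assumes c: "c > -1"
  shows "integrable circ (\<lambda>t. norm (1 + cis (- t)) powr c)"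
    and "circle_mean (\<lambda>t. norm (1 + cis (- t)) powr c) = Gamma (c + 1) / (Gamma (c / 2 + 1))\<^sup>2"
proof -
  let ?h = "\<lambda>t. \<bar>cos (t / 2)\<bar> powr c"
  let ?B = "Beta ((c + 1) / 2) (1 / 2)"
  have 1: "?h absolutely_integrable_on {0..pi}" "integral {0..pi} ?h = ?B"
    using integral_powr_cos[OF c] by auto
  have refl: "(\<lambda>t. 2 * pi - t) ` {pi..2*pi} = {0..pi}"
    by (auto simp: image_iff intro!: bexI[of _ "2 * pi - _"])
  have inv: "?h (2 * pi - t) = ?h t" for t
    by (simp add: diff_divide_distrib cos_diff)
  have 2: "?h absolutely_integrable_on {pi..2*pi} \<and> integral {pi..2*pi} ?h = ?B"
  proof -
    have "((\<lambda>t. 2 * pi - t) has_real_derivative -1) (at x within {pi..2*pi})" for x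
      by (auto intro!: derivative_eq_intros)
    from has_absolute_integral_change_of_variables_1'[OF _ this, of ?h ?B] 1 show ?thesis
      unfolding refl inv by (simp add: inj_on_def)
  qed
  have "((\<lambda>t. ?h t) has_integral (?B + ?B)) {0..2*pi}"
    using 1 2 by (intro has_integral_combine[of 0 pi "2*pi"]) 
      (auto simp: has_integral_iff dest: set_lebesgue_integral_eq_integral)
  hence "((\<lambda>t. 2 powr c * ?h t) has_integral (2 powr c * (2 * ?B))) {0..2*pi}"
    by (intro has_integral_mult_right) simp
  moreover have "2 powr c * ?h t = norm (1 + cis (- t)) powr c" for t
    by (simp add: norm_one_plus_cis powr_mult)
  ultimately have *: "((\<lambda>t. norm (1 + cis (- t)) powr c) has_integral (2 powr c * (2 * ?B))) {0..2*pi}"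
    by simp
  hence "(\<lambda>t. norm (1 + cis (- t)) powr c) absolutely_integrable_on {0..2*pi}"
    by (intro nonnegative_absolutely_integrable_1) (auto simp: has_integral_iff)
  thus int: "integrable circ (\<lambda>t. norm (1 + cis (- t)) powr c)"
    by (simp add: integrable_restrict_space set_integrable_def)
  show "circle_mean (\<lambda>t. norm (1 + cis (- t)) powr c) = Gamma (c + 1) / (Gamma (c / 2 + 1))\<^sup>2"
    unfolding circle_mean_def using * 
    by (subst lebesgue_integral_eq_integral[OF int]) 
       (auto simp: has_integral_iff Beta_half_eq[OF c, symmetric])
qed

text \<open>\<open>g\<close> is a continuous lift of an angle: cis (g t) = (cis t - r) / (1 - r cis
  t) are the boundary values of a disc automorphism, and \<open>g'\<close> is the Poisson kernel. As
  Re (w t) > 0, the principal logarithm is smooth along \<open>w\<close>; at 0 and 2 pi the value of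
  \<open>w\<close> is real, so \<open>g\<close> fixes both end points.\<close>

lemma circle_mean_moebius:
  fixes r m :: real
  assumes r: "0 \<le> r" "r < 1"
  shows "circle_mean (\<lambda>t. norm (1 - of_real r * cis (- t)) powr (- m)) =
         (1 - r\<^sup>2) powr (1 - m) * circle_mean (\<lambda>t. norm (1 + of_real r * cis (- t)) powr (m - 2))"
proof -
  define w where "w t = 1 - complex_of_real r * cis (- t)" for t
  have Re_w: "Re (w t) > 0" for t
  proof -
    have "r * cos t \<le> r * 1" using r by (intro mult_left_mono) auto
    thus ?thesis using r by (simp add: w_def)
  qed
  have nonpos: "w t \<notin> \<real>\<^sub>\<le>\<^sub>0" and w0: "w t \<noteq> 0" for t
    using Re_w[of t] by (auto simp: complex_nonpos_Reals_iff)
  define g where "g t = t + 2 * Im (Ln (w t))" for t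
  define g' where "g' t = (1 - r\<^sup>2) / (norm (w t))\<^sup>2" for t
  have r2: "1 - r\<^sup>2 > 0" using r by (simp add: power_less_one_iff)
  have dg: "(g has_real_derivative g' t) (at t within S)" for t S
  proof -
    have "((\<lambda>t. w t) has_vector_derivative (\<i> * of_real r * cis (- t))) (at t)"
      unfolding w_def by (auto simp: has_vector_derivative_def scaleR_conv_of_real algebra_simps intro!: derivative_eq_intros)
    from field_vector_diff_chain_at[OF this has_field_derivative_Ln[OF nonpos]]
    have "((\<lambda>t. Ln (w t)) has_vector_derivative (\<i> * of_real r * cis (- t) / w t)) (at t)"
      by (simp add: o_def divide_inverse)
    from bounded_linear.has_vector_derivative[OF bounded_linear_Im this]
    have "((\<lambda>t. Im (Ln (w t))) has_real_derivative Im (\<i> * of_real r * cis (- t) / w t)) (at t)"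
      by (simp add: has_real_derivative_iff_has_vector_derivative)
    hence "(g has_real_derivative 1 + 2 * Im (\<i> * of_real r * cis (- t) / w t)) (at t)"
      unfolding g_def by (intro DERIV_add DERIV_ident DERIV_cmult)
    moreover have "1 + 2 * Im (\<i> * of_real r * cis (- t) / w t) = g' t"
    proof -
      have n: "(norm (w t))\<^sup>2 = 1 - 2 * r * cos t + r\<^sup>2"
        using norm_one_plus_sq[of "-r" t] by (simp add: w_def)
      have "of_real r * cis (- t) * cnj (w t) = of_real r * cis (- t) - of_real (r\<^sup>2)"
        by (simp add: w_def cis_cnj algebra_simps power2_eq_square cis_mult)
      hence "\<i> * of_real r * cis (- t) / w t = \<i> * (of_real r * cis (- t) - of_real (r\<^sup>2)) / of_real ((norm (w t))\<^sup>2)"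
        by (subst complex_div_cnj) (simp add: mult.assoc)
      hence "Im (\<i> * of_real r * cis (- t) / w t) = (r * cos t - r\<^sup>2) / (norm (w t))\<^sup>2"
        by (simp only: Im_divide_of_real) simp
      hence "1 + 2 * Im (\<i> * of_real r * cis (- t) / w t) = 1 + 2 * (r * cos t - r\<^sup>2) / (norm (w t))\<^sup>2"
        by simp
      also have "\<dots> = ((norm (w t))\<^sup>2 + 2 * (r * cos t - r\<^sup>2)) / (norm (w t))\<^sup>2"
        using w0[of t] by (simp add: field_simps)
      also have "(norm (w t))\<^sup>2 + 2 * (r * cos t - r\<^sup>2) = 1 - r\<^sup>2" unfolding n by simp
      finally show ?thesis by (simp add: g'_def)
    qed
    ultimately show ?thesis by (auto intro: has_field_derivative_at_within)
  qed
  have cisg: "1 + of_real r * cis (- g t) = of_real (1 - r\<^sup>2) / w t" for t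
  proof -
    have "cis (2 * Im (Ln (w t))) = w t / cnj (w t)"
    proof -
      have "cis (Im (Ln (w t))) = w t / of_real (norm (w t))"
        using cis_Arg[OF w0[of t]] w0[of t] by (simp add: sgn_eq Arg_eq_Im_Ln)
      moreover have "cis (2 * Im (Ln (w t))) = cis (Im (Ln (w t))) * cis (Im (Ln (w t)))"
        by (simp add: cis_mult)
      ultimately have "cis (2 * Im (Ln (w t))) = w t * w t / (w t * cnj (w t))"
        by (simp add: complex_norm_square[symmetric] power2_eq_square)
      thus ?thesis using w0[of t] by simp
    qed
    hence "cis (- (2 * Im (Ln (w t)))) = cnj (w t) / w t"
      by (metis cis_cnj complex_cnj_cnj complex_cnj_divide)
    hence "cis (- g t) = cis (- t) * (cnj (w t) / w t)"
      unfolding g_def using cis_mult[of "- t" "- (2 * Im (Ln (w t)))"] by simp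
    hence "1 + of_real r * cis (- g t) = (w t + of_real r * cis (- t) * cnj (w t)) / w t"
      using w0[of t] by (simp add: field_simps)
    also have "w t + of_real r * cis (- t) * cnj (w t) = of_real (1 - r\<^sup>2)"
      by (simp add: w_def cis_cnj algebra_simps power2_eq_square cis_mult)
    finally show ?thesis .
  qed
  \<comment> \<open>By \<open>cisg\<close> the modulus is (1 - r^2) / |w|; its power m - 2 combines
    with the factor (1 - r^2) / |w|^2 coming from \<open>g'\<close>.\<close>
  have subst: "g' t *\<^sub>R norm (1 + of_real r * cis (- g t)) powr (m - 2) = (1 - r\<^sup>2) powr (m - 1) * norm (w t) powr (- m)" for t
  proof -
    have nw: "norm (w t) > 0" using w0[of t] by simp
    have "norm (1 + of_real r * cis (- g t)) = (1 - r\<^sup>2) / norm (w t)"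
      unfolding cisg norm_divide norm_of_real using r2 by simp
    hence "norm (1 + of_real r * cis (- g t)) powr (m - 2) = (1 - r\<^sup>2) powr (m - 2) / norm (w t) powr (m - 2)"
      using r2 by (simp add: powr_divide)
    moreover have "(1 - r\<^sup>2) powr (m - 1) = (1 - r\<^sup>2) powr (m - 2) * (1 - r\<^sup>2)"
      using powr_add[of "1 - r\<^sup>2" "m - 2" 1] r2 by simp
    moreover have "norm (w t) powr m = norm (w t) powr (m - 2) * (norm (w t))\<^sup>2"
      using powr_add[of "norm (w t)" "m - 2" 2] nw by simp
    ultimately show ?thesis
      by (simp only: g'_def powr_minus divide_inverse real_scaleR_def inverse_mult_distrib mult_ac)
  qed
  have g_ends: "g 0 = 0" "g (2 * pi) = 2 * pi"
  proof -
    have "cis (- (2 * pi)) = 1" using cis_2pi cis_cnj[of "2 * pi"] by simp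
    hence "w 0 = of_real (1 - r)" "w (2 * pi) = of_real (1 - r)" by (simp_all add: w_def)
    moreover have "Im (Ln (of_real (1 - r))) = 0" using r by (subst Ln_of_real) auto
    ultimately show "g 0 = 0" "g (2 * pi) = 2 * pi" by (simp_all add: g_def)
  qed
  have cont1: "continuous_on S (\<lambda>t. norm (1 + of_real r * cis (- t)) powr (m - 2))" for S
  proof -
    have "1 + of_real r * cis (- t) \<noteq> 0" for t
    proof -
      have "- r \<le> r * cos t" using mult_left_mono[OF cos_ge_minus_one[of t] r(1)] by simp
      hence "0 < norm (1 + complex_of_real r * cis (- t))"
        using norm_one_plus_ge[OF r(1), of t] r by linarith
      thus ?thesis by simp
    qed
    thus ?thesis by (auto intro!: continuous_intros)
  qed
  have "((\<lambda>t. g' t *\<^sub>R norm (1 + of_real r * cis (- g t)) powr (m - 2)) has_integral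
          (integral {g 0..g (2*pi)} (\<lambda>t. norm (1 + of_real r * cis (- t)) powr (m - 2)))) {0..2*pi}"
  proof (rule has_integral_substitution[where c = "- 2 * pi" and d = "4 * pi"])
    \<comment> \<open>The integrand is continuous on the whole line, so the crude range that follows
      from |Im Ln| <= pi is good enough.\<close>
    show "g ` {0..2*pi} \<subseteq> {- 2 * pi..4 * pi}"
    proof clarify
      fix t assume "t \<in> {0..2*pi}"
      thus "g t \<in> {- 2 * pi..4 * pi}"
        using mpi_less_Im_Ln[OF w0[of t]] Im_Ln_le_pi[OF w0[of t]] by (auto simp: g_def)
    qed
  qed (use cont1 dg g_ends in auto)
  hence "((\<lambda>t. (1 - r\<^sup>2) powr (m - 1) * norm (w t) powr (- m)) has_integral
          (integral {0..2*pi} (\<lambda>t. norm (1 + of_real r * cis (- t)) powr (m - 2)))) {0..2*pi}"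
    unfolding subst g_ends .
  hence "(1 - r\<^sup>2) powr (m - 1) * integral {0..2*pi} (\<lambda>t. norm (w t) powr (- m)) =
         integral {0..2*pi} (\<lambda>t. norm (1 + of_real r * cis (- t)) powr (m - 2))"
    by (metis integral_unique integral_mult_right)
  then have mean: "integral {0..2*pi} (\<lambda>t. norm (1 + of_real r * cis (- t)) powr (m - 2)) = 
      (1 - r\<^sup>2) powr (m - 1) * integral {0..2*pi} (\<lambda>t. norm (w t) powr (- m))" ..
  have "(1 - r\<^sup>2) powr (1 - m) * (1 - r\<^sup>2) powr (m - 1) = 1"
    using r2 by (simp flip: powr_add)
  hence "integral {0..2*pi} (\<lambda>t. norm (w t) powr (- m)) = (1 - r\<^sup>2) powr (1 - m) *
         integral {0..2*pi} (\<lambda>t. norm (1 + of_real r * cis (- t)) powr (m - 2))"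
    unfolding mean mult.assoc[symmetric] by simp
  moreover have "continuous_on {0..2*pi} (\<lambda>t. norm (w t) powr (- m))"
    using w0 unfolding w_def by (auto intro!: continuous_intros)
  ultimately show ?thesis
    using cont1 unfolding circle_mean_def w_def[symmetric] by (simp add: integral_circ_continuous)
qed

section \<open>Power means on circles\<close>

definition power_mean :: "real \<Rightarrow> real \<Rightarrow> real" where
  "power_mean c r = circle_mean (\<lambda>t. norm (1 + of_real r * cis (- t)) powr c)"

lemma circle_mean_nonneg:
  fixes h :: "real \<Rightarrow> real"
  shows "(\<And>t. h t \<ge> 0) \<Longrightarrow> circle_mean h \<ge> 0"
  by (simp add: circle_mean_def Bochner_Integration.integral_nonneg)

lemma circle_mean_mono:
  fixes h :: "real \<Rightarrow> real"
  assumes "integrable circ h" "integrable circ k" "\<And>t. h t \<le> k t"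
  shows "circle_mean h \<le> circle_mean k"
  using assms by (auto simp: circle_mean_def intro!: mult_left_mono integral_mono divide_right_mono)

lemma circle_mean_const: "circle_mean (\<lambda>t. a :: real) = a"
  unfolding circle_mean_def by (subst integral_circ_continuous) auto

lemma power_mean_nonneg: "power_mean c r \<ge> 0"
  by (simp add: power_mean_def circle_mean_nonneg)

lemma hypergeo_eq_power_mean:
  assumes "0 \<le> r" "r < 1"
  shows "hypergeo (1 - c / 2) (1 - c / 2) 1 (r\<^sup>2) = power_mean (c - 2) r"
  using hypergeo_eq_circle_mean(2)[of "of_real r" "1 - c / 2"] assms
  by (simp add: power_mean_def algebra_simps)

lemma power_mean_one:
  "c > -1 \<Longrightarrow> power_mean c 1 = Gamma (c + 1) / (Gamma (c / 2 + 1))\<^sup>2"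
  by (simp add: power_mean_def circle_mean_boundary)

lemma power_mean_mono:
  assumes "0 \<le> r" "r \<le> r'" "r' < 1"
  shows "power_mean c r \<le> power_mean c r'"
proof (rule sums_le)
  let ?t = "\<lambda>r n. (pochhammer (- c / 2) n)\<^sup>2 / (fact n)\<^sup>2 * (r\<^sup>2) ^ n"
  show "?t r sums power_mean c r" "?t r' sums power_mean c r'"
    using hypergeo_eq_circle_mean(1)[of "of_real r" "- c / 2"] assms
      hypergeo_eq_circle_mean(1)[of "of_real r'" "- c / 2"] 
    by (simp_all add: power_mean_def)
  show "?t r n \<le> ?t r' n" for n
    using assms by (intro mult_left_mono power_mono) auto
qed

text \<open>A lower bound uniform in r, which yields an integrable majorant for negative exponents.
  For cos t <= 1/2 one completes the square in r + cos t, leaving the nonnegative remainder (1 + cos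
  t)(1/2 - cos t); otherwise all terms involving r are nonnegative.\<close>

lemma norm_one_plus_ge_half:
  assumes "0 \<le> r"
  shows "norm (1 + cis (- t)) / 2 \<le> norm (1 + of_real r * cis (- t))"
proof (rule power2_le_imp_le)
  have "(1 + cos t) / 2 \<le> 1 + 2 * r * cos t + r\<^sup>2"
  proof (cases "cos t \<le> 1 / 2")
    case True
    have "(1 + cos t) * (1 / 2 - cos t) \<ge> 0"
      using True cos_ge_minus_one[of t] by (intro mult_nonneg_nonneg) linarith+
    moreover have "1 + 2 * r * cos t + r\<^sup>2 - (1 + cos t) / 2 = (r + cos t)\<^sup>2 + (1 + cos t) * (1 / 2 - cos t)"
      by (simp add: power2_eq_square field_simps)
    ultimately show ?thesis using zero_le_power2[of "r + cos t"] by linarith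
  next
    case False
    hence "2 * r * cos t \<ge> 0" using assms by simp
    moreover have "(1 + cos t) / 2 \<le> 1" using cos_le_one[of t] by simp
    ultimately show ?thesis using zero_le_power2[of r] by linarith
  qed
  thus "(norm (1 + cis (- t)) / 2)\<^sup>2 \<le> (norm (1 + of_real r * cis (- t)))\<^sup>2"
    using norm_one_plus_sq[of r t] norm_one_plus_sq[of 1 t] by (simp add: power_divide)
qed auto

lemma norm_one_plus_le:
  assumes "0 \<le> r"
  shows "norm (1 + of_real r * cis (- t)) \<le> 1 + r"
  using norm_triangle_ineq[of 1 "of_real r * cis (- t)"] assms by (simp add: norm_mult)

lemma AE_circ_neq: "AE t in circ. t \<noteq> a"
proof -
  have "AE t in lebesgue. t \<noteq> a"
    by (rule AE_completion) (rule AE_lborel_singleton)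
  hence "AE t in lebesgue. t \<in> {0..2*pi} \<longrightarrow> t \<noteq> a" by eventually_elim simp
  thus ?thesis by (simp add: AE_restrict_space_iff)
qed

lemma measurable_circ_norm_powr:
  "(\<lambda>t. norm (1 + z * cis (- t)) powr c) \<in> borel_measurable circ"
proof -
  have "(\<lambda>t. norm (1 + z * cis (- t)) powr c) \<in> borel_measurable borel"
    by (intro powr_real_measurable borel_measurable_const borel_measurable_continuous_onI continuous_intros)
  thus ?thesis by (intro measurable_restrict_space1 measurable_completion) simp
qed

text \<open>Dominated convergence. The delicate range is -1 < c < 0, where the limit function is
  unbounded near t = pi; the factor 1/2 in \<open>norm_one_plus_ge_half\<close> makes the boundary
  function itself a majorant, up to a constant.\<close>

lemma power_mean_tendsto:
  assumes c: "c > -1"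
  shows "(power_mean c \<longlongrightarrow> power_mean c 1) (at_left 1)"
proof (rule tendsto_at_left_sequentially[of 0])
  fix S :: "nat \<Rightarrow> real" assume S: "\<And>n. S n < 1" "\<And>n. 0 < S n" "S \<longlonglongrightarrow> 1"
  have pi0: "1 + cis (- t) \<noteq> 0" if "t \<in> {0..2*pi}" "t \<noteq> pi" for t
  proof -
    have "cos (t / 2) \<noteq> 0"
    proof
      assume "cos (t / 2) = 0"
      hence c: "cos (t / 2) = cos (pi / 2)" by simp
      have "t / 2 = pi / 2" by (rule cos_inj_pi[OF _ _ _ _ c]) (use that(1) pi_gt_zero in simp_all)
      thus False using that by simp
    qed
    thus ?thesis using norm_one_plus_cis[of t] by (metis abs_eq_0 mult_eq_0_iff norm_zero zero_neq_numeral)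
  qed
  \<comment> \<open>The constant dominates when c >= 0, the second summand when c < 0.\<close>
  let ?w = "\<lambda>t. 2 powr c + (1 / 2) powr c * norm (1 + cis (- t)) powr c"
  have AE: "AE t in circ. t \<in> {0..2*pi} \<and> t \<noteq> pi"
    using AE_circ_neq[of pi] AE_space by eventually_elim simp
  have "(\<lambda>n. LINT t|circ. norm (1 + of_real (S n) * cis (- t)) powr c) \<longlonglongrightarrow> 
        (LINT t|circ. norm (1 + of_real 1 * cis (- t)) powr c)"
  proof (rule integral_dominated_convergence)
    show "integrable circ ?w"
      by (intro Bochner_Integration.integrable_add integrable_mult_right circle_mean_boundary c integrable_circ_continuous continuous_intros)
    show "AE t in circ. (\<lambda>n. norm (1 + of_real (S n) * cis (- t)) powr c) \<longlonglongrightarrow> norm (1 + of_real 1 * cis (- t)) powr c"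
      using AE
    proof eventually_elim
      fix t assume t: "t \<in> {0..2*pi} \<and> t \<noteq> pi"
      have "(\<lambda>n. norm (1 + of_real (S n) * cis (- t))) \<longlonglongrightarrow> norm (1 + of_real 1 * cis (- t))"
        by (intro tendsto_intros S)
      thus "(\<lambda>n. norm (1 + of_real (S n) * cis (- t)) powr c) \<longlonglongrightarrow> norm (1 + of_real 1 * cis (- t)) powr c"
        using pi0 t by (intro tendsto_powr tendsto_const) auto
    qed
    fix n
    show "AE t in circ. norm (norm (1 + of_real (S n) * cis (- t)) powr c) \<le> ?w t"
      using AE
    proof eventually_elim
      fix t assume t: "t \<in> {0..2*pi} \<and> t \<noteq> pi"
      show "norm (norm (1 + of_real (S n) * cis (- t)) powr c) \<le> ?w t"
      proof (cases "c \<ge> 0")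
        case True
        have "norm (1 + of_real (S n) * cis (- t)) \<le> 2"
          using norm_one_plus_le[of "S n" t] S(1)[of n] S(2)[of n] by simp
        hence "norm (1 + of_real (S n) * cis (- t)) powr c \<le> 2 powr c"
          using True by (intro powr_mono2) auto
        thus ?thesis by (simp add: add_increasing2)
      next
        case False
        have "norm (1 + of_real (S n) * cis (- t)) powr c \<le> (norm (1 + cis (- t)) / 2) powr c"
          using False pi0 t S(2)[of n] by (intro powr_mono2' norm_one_plus_ge_half) auto
        also have "\<dots> = (1 / 2) powr c * norm (1 + cis (- t)) powr c"
          by (simp flip: powr_mult)
        finally show ?thesis by (simp add: add_increasing)
      qed
    qed
  qed (rule measurable_circ_norm_powr)+
  from tendsto_mult[OF tendsto_const[of "1 / (2*pi)"] this] show "(\<lambda>n. power_mean c (S n)) \<longlonglongrightarrow> power_mean c 1"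
    by (simp add: power_mean_def circle_mean_def)
qed auto

text \<open>Monotonicity comes from the series and stops short of r = 1; the limit carries it to the
  end point.\<close>

lemma power_mean_le_one:
  assumes "c > -1" "0 \<le> r" "r < 1"
  shows "power_mean c r \<le> power_mean c 1"
proof (rule tendsto_lowerbound[OF power_mean_tendsto[OF assms(1)]])
  have "eventually (\<lambda>x. x \<in> {r<..<1}) (at_left 1)"
    using assms by (intro eventually_at_left_real)
  thus "\<forall>\<^sub>F x in at_left 1. power_mean c r \<le> power_mean c x"
    by eventually_elim (use assms in \<open>auto intro: power_mean_mono\<close>)
qed simp

section \<open>Power means as the exponent tends to infinity\<close>

lemma power_mean_le:
  assumes c: "c > 0" and r: "0 \<le> r"
  shows "power_mean c r \<le> (1 + r) powr c"
proof -
  have "power_mean c r \<le> circle_mean (\<lambda>_. (1 + r) powr c)" unfolding power_mean_def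
    using c r by (intro circle_mean_mono integrable_circ_continuous powr_mono2 norm_one_plus_le)
      (auto intro!: continuous_intros continuous_on_powr')
  thus ?thesis by (simp add: circle_mean_const)
qed

text \<open>Only the arc {0..\<delta>} next to the maximum at t = 0 is kept, with its share \<delta>
  / (2 pi) of the circle. Later \<delta> = 1/q, and the q-th root of this share tends to 1.\<close>

lemma power_mean_ge:
  assumes c: "c > 0" and r: "0 \<le> r" and \<delta>: "0 < \<delta>" "\<delta> \<le> 1"
  shows "\<delta> / (2 * pi) * (1 + r * cos \<delta>) powr c \<le> power_mean c r"
proof -
  let ?h = "\<lambda>t. norm (1 + of_real r * cis (- t)) powr c"
  have cont: "continuous_on S ?h" for S
    using c by (auto intro!: continuous_intros continuous_on_powr')
  have d: "\<delta> < pi / 2" using \<delta> pi_gt3 by simp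
  have cos: "cos \<delta> > 0" using d \<delta> by (intro cos_gt_zero) auto
  have "\<delta> * (1 + r * cos \<delta>) powr c = integral {0..\<delta>} (\<lambda>_. (1 + r * cos \<delta>) powr c)"
    using \<delta> by simp
  also have "\<dots> \<le> integral {0..\<delta>} ?h"
  proof (rule integral_le)
    fix t assume t: "t \<in> {0..\<delta>}"
    have "cos \<delta> \<le> cos t" using t d by (intro cos_monotone_0_pi_le) auto
    hence "1 + r * cos \<delta> \<le> 1 + r * cos t" using r by (simp add: mult_left_mono)
    also have "\<dots> \<le> norm (1 + of_real r * cis (- t))" by (rule norm_one_plus_ge[OF r])
    finally show "(1 + r * cos \<delta>) powr c \<le> ?h t"
      using r cos c by (intro powr_mono2) auto
  qed (auto intro: integrable_continuous_interval cont)
  also have "\<dots> \<le> integral {0..2*pi} ?h"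
    using d pi_gt_zero by (intro integral_subset_le integrable_continuous_interval cont) auto
  also have "\<dots> = 2 * pi * power_mean c r"
    by (simp add: power_mean_def circle_mean_def integral_circ_continuous cont)
  finally show ?thesis by (simp add: field_simps)
qed

text \<open>The limit is the maximum of \<open>\<bar>1 + r cis (- t)\<bar> powr s\<close>, attained at \<open>t = 0\<close>.\<close>

lemma power_mean_limit:
  assumes s: "s > 0" and r: "0 \<le> r"
  shows "((\<lambda>q. power_mean (s * q - 2) r powr (1 / q)) \<longlongrightarrow> (1 + r) powr s) at_top"
proof -
  have ev: "eventually (\<lambda>q. q \<ge> 1 \<and> s * q - 2 > 0) at_top"
  proof -
    have "eventually (\<lambda>q. q \<ge> max 1 (3 / s)) at_top" by (rule eventually_ge_at_top)
    thus ?thesis by eventually_elim (use s in \<open>auto simp: field_simps\<close>)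
  qed
  have inv: "((\<lambda>q::real. 1 / q) \<longlongrightarrow> 0) at_top"
    by (intro tendsto_divide_0[OF tendsto_const] filterlim_at_top_imp_at_infinity filterlim_ident)
  let ?u = "\<lambda>q. (1 + r) powr (s - 2 * (1 / q))"
  \<comment> \<open>The exponential is the q-th root of 1 / (2 pi q), the share of the arc for
    \<delta> = 1/q, written so that its limit is visible.\<close>
  let ?l = "\<lambda>q. exp (- (ln (2 * pi) * (1 / q) + ln q / q)) * (1 + r * cos (1 / q)) powr (s - 2 * (1 / q))"
  have "(?u \<longlongrightarrow> (1 + r) powr (s - 2 * 0)) at_top"
    using r by (intro tendsto_intros inv) auto
  hence u: "(?u \<longlongrightarrow> (1 + r) powr s) at_top" by simp
  have "(?l \<longlongrightarrow> exp (- (ln (2 * pi) * 0 + 0)) * (1 + r * cos 0) powr (s - 2 * 0)) at_top"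
    using r by (intro tendsto_intros inv ln_x_over_x_tendsto_0) auto
  hence l: "(?l \<longlongrightarrow> (1 + r) powr s) at_top" by simp
  have upper: "eventually (\<lambda>q. power_mean (s * q - 2) r powr (1 / q) \<le> ?u q) at_top"
    using ev
  proof eventually_elim
    fix q assume q: "q \<ge> 1 \<and> s * q - 2 > 0"
    have "power_mean (s * q - 2) r powr (1 / q) \<le> ((1 + r) powr (s * q - 2)) powr (1 / q)"
      using q r by (intro powr_mono2 power_mean_le power_mean_nonneg) auto
    also have "\<dots> = ?u q" using q by (simp add: powr_powr field_simps)
    finally show "power_mean (s * q - 2) r powr (1 / q) \<le> ?u q" .
  qed
  have lower: "eventually (\<lambda>q. ?l q \<le> power_mean (s * q - 2) r powr (1 / q)) at_top"
    using ev
  proof eventually_elim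
    fix q :: real assume q: "q \<ge> 1 \<and> s * q - 2 > 0"
    have "1 / q \<le> 1" "0 \<le> 1 / q" using q by auto
    hence "cos (1 / q) \<ge> 0" using pi_gt3 by (intro cos_ge_zero) linarith+
    hence nn: "0 < 1 + r * cos (1 / q)" using r by (simp add: add_pos_nonneg)
    have "?l q = (1 / q / (2 * pi)) powr (1 / q) * ((1 + r * cos (1 / q)) powr (s * q - 2)) powr (1 / q)"
      using q by (simp add: powr_powr powr_def[of "1 / _"] ln_div ln_mult field_simps)
    also have "\<dots> = (1 / q / (2 * pi) * (1 + r * cos (1 / q)) powr (s * q - 2)) powr (1 / q)"
      by (rule powr_mult[symmetric])
    also have "\<dots> \<le> power_mean (s * q - 2) r powr (1 / q)"
      using q r nn by (intro powr_mono2 power_mean_ge) auto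
    finally show "?l q \<le> power_mean (s * q - 2) r powr (1 / q)" .
  qed
  show ?thesis by (rule tendsto_sandwich[OF lower upper l u])
qed

text \<open>A common form of \<open>F1\<close> (for r < 1) and \<open>Gamma_factor\<close> (at r =
  1): the second inequality of the theorem becomes monotonicity in r, and sharpness uses the limit r
  -> 1 of the same function.\<close>

definition extremal_factor :: "real \<Rightarrow> real \<Rightarrow> real \<Rightarrow> real" where
  "extremal_factor s p r = at_conjugate p (\<lambda>q. power_mean (s * q - 2) r powr (1 / q))"

lemma extremal_factor_1:
  "s > 0 \<Longrightarrow> 0 \<le> r \<Longrightarrow> extremal_factor s 1 r = (1 + r) powr s"
  by (simp add: extremal_factor_def at_conjugate_def tendsto_Lim power_mean_limit)

lemma extremal_factor_gt_1:
  "p > 1 \<Longrightarrow> extremal_factor s p r = power_mean (s * (p / (p - 1)) - 2) r powr (1 - 1 / p)"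
  by (simp add: extremal_factor_def at_conjugate_def diff_divide_distrib)

lemma F1_eq:
  assumes "0 \<le> r" "r < 1"
  shows "F1 \<alpha> \<beta> p r = extremal_factor (Re (\<alpha> + \<beta>) + 2) p r"
  by (simp only: F1_def extremal_factor_def hypergeo_eq_power_mean[OF assms])

text \<open>This is where Re (\<alpha> + \<beta>) > -1, in the form s > 1, makes the boundary mean
  finite: s and the conjugate exponent both exceed 1.\<close>

lemma conjugate_exponent_gt:
  fixes s p :: real
  assumes "s > 1" "p > 1"
  shows "s * (p / (p - 1)) - 2 > -1"
proof -
  have "p / (p - 1) > 1" using assms by simp
  hence "1 * 1 < s * (p / (p - 1))" using assms by (intro mult_strict_mono) auto
  thus ?thesis by simp
qed

lemma Gamma_quotient_eq:
  fixes s q :: real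
  assumes "s * q - 2 > -1"
  shows "Gamma (s * q - 1) / (Gamma (s * q / 2))\<^sup>2 = power_mean (s * q - 2) 1"
  using power_mean_one[OF assms] by (simp add: diff_divide_distrib)

text \<open>For p = 1 the value is a \<open>Lim\<close>, so the limit has to be identified: for q >
  1 the Gamma quotient is a boundary mean, and \<open>power_mean_limit\<close> at r = 1 gives 2 powr
  s.\<close>

lemma Gamma_factor_eq:
  assumes "Re (\<alpha> + \<beta>) > -1" "p \<ge> 1"
  shows "Gamma_factor \<alpha> \<beta> p = extremal_factor (Re (\<alpha> + \<beta>) + 2) p 1"
proof -
  define s where "s = Re (\<alpha> + \<beta>) + 2"
  have s: "s > 1" using assms by (simp add: s_def)
  show ?thesis
  proof (cases "p = 1")
    case True
    have "eventually (\<lambda>q::real. q > 1) at_top" by (rule eventually_gt_at_top)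
    hence "eventually (\<lambda>q. power_mean (s * q - 2) 1 powr (1 / q) =
             (Gamma (s * q - 1) / (Gamma (s * q / 2))\<^sup>2) powr (1 / q)) at_top"
    proof eventually_elim
      fix q :: real assume "q > 1"
      hence "1 * 1 < s * q" using s by (intro mult_strict_mono) auto
      thus "power_mean (s * q - 2) 1 powr (1 / q) =
             (Gamma (s * q - 1) / (Gamma (s * q / 2))\<^sup>2) powr (1 / q)"
        using Gamma_quotient_eq by simp
    qed
    moreover have "((\<lambda>q. power_mean (s * q - 2) 1 powr (1 / q)) \<longlongrightarrow> (1 + 1) powr s) at_top"
      using s by (intro power_mean_limit) auto
    ultimately have "((\<lambda>q. (Gamma (s * q - 1) / (Gamma (s * q / 2))\<^sup>2) powr (1 / q)) \<longlongrightarrow> (1 + 1) powr s) at_top"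
      by (blast intro: Lim_transform_eventually)
    thus ?thesis using s True extremal_factor_1[of s 1]
      by (simp add: Gamma_factor_def at_conjugate_def s_def tendsto_Lim)
  next
    case False
    hence "p > 1" using assms by simp
    from Gamma_quotient_eq[OF conjugate_exponent_gt[OF s this]] show ?thesis
      using False by (simp add: Gamma_factor_def extremal_factor_def at_conjugate_def s_def)
  qed
qed

lemma extremal_factor_nonneg:
  assumes "s > 0" "p \<ge> 1" "0 \<le> r"
  shows "extremal_factor s p r \<ge> 0"
  using assms extremal_factor_1[of s r] extremal_factor_gt_1[of p s r] by (cases "p = 1") auto

lemma extremal_factor_le_one:
  assumes "s > 1" "p \<ge> 1" "0 \<le> r" "r < 1"
  shows "extremal_factor s p r \<le> extremal_factor s p 1"
proof (cases "p = 1")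
  case True
  thus ?thesis using assms by (auto simp: extremal_factor_1 intro!: powr_mono2)
next
  case False
  hence "p > 1" using assms by simp
  with assms show ?thesis
    unfolding extremal_factor_gt_1[OF \<open>p > 1\<close>]
    by (intro powr_mono2 power_mean_le_one conjugate_exponent_gt power_mean_nonneg) auto
qed

lemma extremal_factor_one_pos:
  assumes "s > 1" "p \<ge> 1"
  shows "extremal_factor s p 1 > 0"
proof (cases "p = 1")
  case True
  thus ?thesis using assms by (auto simp: extremal_factor_1)
next
  case False
  hence p: "p > 1" using assms by simp
  note c = conjugate_exponent_gt[OF assms(1) p]
  have "power_mean (s * (p / (p - 1)) - 2) 1 > 0"
    unfolding power_mean_one[OF c] by (intro divide_pos_pos zero_less_power Gamma_real_pos) (use c in argo)+
  thus ?thesis unfolding extremal_factor_gt_1[OF p] by simp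
qed

lemma extremal_factor_tendsto_one:
  assumes "s > 1" "p \<ge> 1"
  shows "(extremal_factor s p \<longlongrightarrow> extremal_factor s p 1) (at_left 1)"
proof (cases "p = 1")
  case True
  have "eventually (\<lambda>r::real. r \<in> {0<..<1}) (at_left 1)" by (intro eventually_at_left_real) auto
  hence "eventually (\<lambda>r. (1 + r) powr s = extremal_factor s p r) (at_left 1)"
    by eventually_elim (use True assms in \<open>auto simp: extremal_factor_1\<close>)
  moreover have "((\<lambda>r. (1 + r) powr s) \<longlongrightarrow> (1 + 1) powr s) (at_left 1)"
    by (intro tendsto_intros) auto
  ultimately show ?thesis
    using True assms by (auto simp: extremal_factor_1 intro: Lim_transform_eventually)
next
  case False
  hence p: "p > 1" using assms by simp
  show ?thesis unfolding extremal_factor_gt_1[OF p]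
    using p by (intro tendsto_powr' power_mean_tendsto conjugate_exponent_gt assms tendsto_const)
      (auto simp: power_mean_nonneg)
qed

text \<open>For p > 1 the dependence on s is moved into the Gamma quotient, where it is continuity
  of Gamma at positive arguments and no integral with a varying exponent has to be studied.\<close>

lemma extremal_factor_isCont:
  assumes "s > 1" "p \<ge> 1"
  shows "isCont (\<lambda>s. extremal_factor s p 1) s"
proof (cases "p = 1")
  case True
  have "eventually (\<lambda>s::real. s > 1) (nhds s)" using assms by (intro eventually_nhds_in_open[of "{1<..}" s, simplified])
  hence "eventually (\<lambda>s. extremal_factor s p 1 = 2 powr s) (nhds s)"
    by eventually_elim (use True in \<open>auto simp: extremal_factor_1\<close>)
  moreover have "isCont (\<lambda>s. 2 powr s :: real) s"
    unfolding isCont_def by (intro tendsto_powr tendsto_const tendsto_ident_at) auto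
  ultimately show ?thesis by (rule iffD2[OF isCont_cong])
next
  case False
  hence p: "p > 1" using assms by simp
  define q where "q = p / (p - 1)"
  let ?G = "\<lambda>s. (Gamma (s * q - 1) / (Gamma (s * q / 2))\<^sup>2) powr (1 - 1 / p)"
  have "eventually (\<lambda>s::real. s > 1) (nhds s)" using assms by (intro eventually_nhds_in_open[of "{1<..}" s, simplified])
  hence "eventually (\<lambda>s. extremal_factor s p 1 = ?G s) (nhds s)"
  proof eventually_elim
    fix s :: real assume "s > 1"
    from Gamma_quotient_eq[OF conjugate_exponent_gt[OF this p]]
    show "extremal_factor s p 1 = ?G s" by (simp only: extremal_factor_gt_1[OF p] q_def)
  qed
  moreover have "isCont ?G s"
  proof -
    have c: "s * q - 1 > 0" using conjugate_exponent_gt[OF assms(1) p] by (simp add: q_def)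
    hence "Gamma (s * q - 1) > 0" "Gamma (s * q / 2) > 0" by (auto intro!: Gamma_real_pos)
    moreover have "s * q - 1 \<notin> \<int>\<^sub>\<le>\<^sub>0" "s * q / 2 \<notin> \<int>\<^sub>\<le>\<^sub>0" using c by (auto elim!: nonpos_Ints_cases)
    ultimately show ?thesis
      by (intro continuous_intros) auto
  qed
  ultimately show ?thesis by (rule iffD2[OF isCont_cong])
qed

section \<open>The Hoelder inequality for the kernel\<close>

text \<open>Young's inequality for u / a and v / b, with a and b the two norms. If a norm vanishes
  this normalisation is impossible, but then the product is zero almost everywhere.\<close>

lemma Hoelder_inequality:
  fixes u v :: "'a \<Rightarrow> real"
  assumes pq: "p > 1" "q > 1" "1 / p + 1 / q = 1"
    and meas: "u \<in> borel_measurable M" "v \<in> borel_measurable M"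
    and nn: "\<And>x. u x \<ge> 0" "\<And>x. v x \<ge> 0"
    and int: "integrable M (\<lambda>x. u x powr p)" "integrable M (\<lambda>x. v x powr q)"
  shows "integrable M (\<lambda>x. u x * v x)"
    and "(LINT x|M. u x * v x) \<le> (LINT x|M. u x powr p) powr (1 / p) * (LINT x|M. v x powr q) powr (1 / q)"
proof -
  show int_uv: "integrable M (\<lambda>x. u x * v x)"
  proof (rule Bochner_Integration.integrable_bound)
    show "integrable M (\<lambda>x. u x powr p / p + v x powr q / q)" using int by simp
    show "AE x in M. norm (u x * v x) \<le> norm (u x powr p / p + v x powr q / q)"
      using Youngs_inequality[OF pq nn] nn pq by (intro AE_I2) (simp add: order_trans[OF _ abs_ge_self])
  qed (use meas in measurable)
  define A where "A = (LINT x|M. u x powr p)"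
  define B where "B = (LINT x|M. v x powr q)"
  have AB: "A \<ge> 0" "B \<ge> 0" unfolding A_def B_def by (auto intro: Bochner_Integration.integral_nonneg)
  have zero: "(LINT x|M. u x * v x) = 0" if "A = 0 \<or> B = 0"
  proof -
    have "AE x in M. u x * v x = 0"
      using that
    proof
      assume "A = 0"
      hence "AE x in M. u x powr p = 0" unfolding A_def using int by (subst (asm) integral_nonneg_eq_0_iff_AE) auto
      thus ?thesis by eventually_elim simp
    next
      assume "B = 0"
      hence "AE x in M. v x powr q = 0" unfolding B_def using int by (subst (asm) integral_nonneg_eq_0_iff_AE) auto
      thus ?thesis by eventually_elim simp
    qed
    hence "(LINT x|M. u x * v x) = (LINT x|M. 0)" using meas by (intro integral_cong_AE) auto
    thus ?thesis by simp
  qed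
  have "(LINT x|M. u x * v x) \<le> A powr (1 / p) * B powr (1 / q)"
  proof (cases "A = 0 \<or> B = 0")
    case True
    thus ?thesis using zero by simp
  next
    case False
    hence pos: "A > 0" "B > 0" using AB by auto
    define a b where "a = A powr (1 / p)" and "b = B powr (1 / q)"
    have ab: "a > 0" "b > 0" using pos by (auto simp: a_def b_def)
    have abp: "a powr p = A" "b powr q = B" using pos pq by (auto simp: a_def b_def powr_powr)
    have "(LINT x|M. u x * v x) / (a * b) = (LINT x|M. (u x / a) * (v x / b))" by simp
    also have "\<dots> \<le> (LINT x|M. u x powr p * (1 / (A * p)) + v x powr q * (1 / (B * q)))"
    proof (rule integral_mono)
      show "integrable M (\<lambda>x. (u x / a) * (v x / b))" using int_uv by simp
      show "integrable M (\<lambda>x. u x powr p * (1 / (A * p)) + v x powr q * (1 / (B * q)))" using int by simp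
      show "(u x / a) * (v x / b) \<le> u x powr p * (1 / (A * p)) + v x powr q * (1 / (B * q))" for x
        using Youngs_inequality[OF pq, of "u x / a" "v x / b"] nn ab by (simp add: powr_divide abp)
    qed
    also have "\<dots> = A * (1 / (A * p)) + B * (1 / (B * q))"
      unfolding A_def B_def by (subst Bochner_Integration.integral_add) (use int in auto)
    also have "\<dots> = 1" using pos pq by simp
    finally show ?thesis using ab by (simp add: field_simps a_def b_def)
  qed
  thus "(LINT x|M. u x * v x) \<le> (LINT x|M. u x powr p) powr (1 / p) * (LINT x|M. v x powr q) powr (1 / q)"
    by (simp add: A_def B_def)
qed

lemma Hoelder_circle_mean:
  fixes u v :: "real \<Rightarrow> real"
  assumes pq: "p > 1" "q > 1" "1 / p + 1 / q = 1"
    and meas: "u \<in> borel_measurable circ" "v \<in> borel_measurable circ"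
    and nn: "\<And>x. u x \<ge> 0" "\<And>x. v x \<ge> 0"
    and int: "integrable circ (\<lambda>x. u x powr p)" "integrable circ (\<lambda>x. v x powr q)"
  shows "circle_mean (\<lambda>x. u x * v x) \<le> circle_mean (\<lambda>x. u x powr p) powr (1 / p) * circle_mean (\<lambda>x. v x powr q) powr (1 / q)"
proof -
  let ?c = "1 / (2 * pi)"
  let ?A = "LINT x|circ. u x powr p" and ?B = "LINT x|circ. v x powr q"
  have nnAB: "?A \<ge> 0" "?B \<ge> 0" by (auto intro: Bochner_Integration.integral_nonneg)
  have "circle_mean (\<lambda>x. u x * v x) \<le> ?c * (?A powr (1 / p) * ?B powr (1 / q))"
    unfolding circle_mean_def real_scaleR_def
    by (intro mult_left_mono Hoelder_inequality assms) auto
  \<comment> \<open>Since 1/p + 1/q = 1, the normalising factor splits between the two means and no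
    constant is left over.\<close>
  also have "?c = ?c powr (1 / p) * ?c powr (1 / q)"
    using pq by (simp flip: powr_add)
  also have "?c powr (1 / p) * ?c powr (1 / q) * (?A powr (1 / p) * ?B powr (1 / q)) = 
      (?c * ?A) powr (1 / p) * (?c * ?B) powr (1 / q)"
    using nnAB by (simp only: powr_mult mult_ac)
  finally show ?thesis by (simp only: circle_mean_def real_scaleR_def)
qed

lemma Lp_norm_eq: "Lp_norm p f = circle_mean (\<lambda>t. norm (f (cis t)) powr p) powr (1 / p)"
  by (simp add: Lp_norm_def circle_mean_def)

lemma Lp_norm_nonneg: "Lp_norm p f \<ge> 0"
  by (simp add: Lp_norm_def)

text \<open>On a space of finite measure x <= 1 + x powr p suffices.\<close>

lemma Lp_circle_integrable:
  assumes "f \<in> Lp_circle p" "p \<ge> 1"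
  shows "integrable circ (\<lambda>t. f (cis t))"
proof (rule Bochner_Integration.integrable_bound)
  show "integrable circ (\<lambda>t. 1 + norm (f (cis t)) powr p)"
    using assms integrable_circ_continuous[of "\<lambda>_. 1 :: real"]
    by (intro Bochner_Integration.integrable_add) (auto simp: Lp_circle_def)
  have "x \<le> 1 + x powr p" if "x \<ge> 0" for x :: real
  proof (cases "x \<le> 1")
    case False
    hence "x powr 1 \<le> x powr p" using assms by (intro powr_mono) auto
    thus ?thesis using False by simp
  qed (simp add: add_increasing2)
  thus "AE t in circ. norm (f (cis t)) \<le> norm (1 + norm (f (cis t)) powr p)"
    by (intro AE_I2) (simp add: order_trans[OF _ abs_ge_self])
qed (use assms in \<open>auto simp: Lp_circle_def\<close>)

lemma circle_mean_kernel_power: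
  assumes z: "norm z < 1"
  shows "circle_mean (\<lambda>t. norm (1 - z * cis (- t)) powr (- m)) =
         (1 - (norm z)\<^sup>2) powr (1 - m) * power_mean (m - 2) (norm z)"
proof -
  \<comment> \<open>Rotation invariance without a change of variables: by the hypergeometric series
    both means depend on |z| only.\<close>
  have "circle_mean (\<lambda>t. norm (1 - z * cis (- t)) powr (- m)) = 
        circle_mean (\<lambda>t. norm (1 - of_real (norm z) * cis (- t)) powr (- m))"
    using hypergeo_eq_circle_mean(2)[of "- z" "m / 2"] hypergeo_eq_circle_mean(2)[of "- of_real (norm z)" "m / 2"] z
    by simp
  thus ?thesis using circle_mean_moebius[of "norm z" m] z by (simp add: power_mean_def)
qed

lemma one_minus_neq_0:
  fixes z :: complex
  shows "norm z < 1 \<Longrightarrow> 1 - z * cis t \<noteq> 0"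
  by (metis eq_iff_diff_eq_0 mult.right_neutral norm_cis norm_mult norm_one order_less_irrefl)

lemma continuous_on_norm_kernel_powr:
  assumes z: "norm z < 1"
  shows "continuous_on S (\<lambda>t. norm (1 - z * cis (- t)) powr m)"
  using one_minus_neq_0[OF z] by (intro continuous_intros) auto

text \<open>Hoelder with the kernel in L^q; the q-th root turns the power 1 - s q of 1 - r^2 into 1
  - 1/p - s. For p = 1 the kernel is bounded by its supremum (1 - r) powr (- s), and 1 - r^2 = (1 -
  r)(1 + r) produces the factor (1 + r) powr s.\<close>

lemma kernel_mean_bound:
  assumes z: "norm z < 1" and f: "f \<in> Lp_circle p" and p: "p \<ge> 1" and s: "s > 0"
  shows "circle_mean (\<lambda>t. norm (1 - z * cis (- t)) powr (- s) * norm (f (cis t))) \<le>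
         (1 - (norm z)\<^sup>2) powr (1 - 1 / p - s) * extremal_factor s p (norm z) * Lp_norm p f"
proof (cases "p = 1")
  case True
  define r where "r = norm z"
  have r: "0 \<le> r" "r < 1" using z by (auto simp: r_def)
  have bd: "norm (1 - z * cis (- t)) powr (- s) \<le> (1 - r) powr (- s)" for t
  proof (rule powr_mono2')
    show "1 - r \<le> norm (1 - z * cis (- t))"
      using norm_triangle_ineq2[of 1 "z * cis (- t)"] by (simp add: norm_mult r_def)
  qed (use s r in auto)
  have "circle_mean (\<lambda>t. norm (1 - z * cis (- t)) powr (- s) * norm (f (cis t))) \<le>
        circle_mean (\<lambda>t. (1 - r) powr (- s) * norm (f (cis t)))"
  proof (rule circle_mean_mono)
    show "integrable circ (\<lambda>t. norm (1 - z * cis (- t)) powr (- s) * norm (f (cis t)))"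
    proof (rule Bochner_Integration.integrable_bound)
      show "integrable circ (\<lambda>t. (1 - r) powr (- s) * norm (f (cis t)))"
        using Lp_circle_integrable[OF f p] by auto
      show "(\<lambda>t. norm (1 - z * cis (- t)) powr (- s) * norm (f (cis t))) \<in> borel_measurable circ"
        using Lp_circle_integrable[OF f p] measurable_circ_norm_powr[of "- z"]
        by (intro borel_measurable_times borel_measurable_norm) auto
    qed (use bd in \<open>auto intro!: AE_I2 mult_right_mono\<close>)
    show "integrable circ (\<lambda>t. (1 - r) powr (- s) * norm (f (cis t)))"
      using Lp_circle_integrable[OF f p] by auto
  qed (use bd in \<open>auto intro!: mult_right_mono\<close>)
  also have "\<dots> = (1 - r) powr (- s) * Lp_norm p f"
    using True by (simp add: Lp_norm_eq circle_mean_def)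
  also have "(1 - r) powr (- s) = (1 - r\<^sup>2) powr (1 - 1 / p - s) * extremal_factor s p r"
  proof -
    have "1 - r\<^sup>2 = (1 - r) * (1 + r)" by (simp add: power2_eq_square algebra_simps)
    thus ?thesis using True r s by (simp add: extremal_factor_1 powr_mult mult.assoc flip: powr_add)
  qed
  finally show ?thesis by (simp add: r_def)
next
  case False
  hence p: "p > 1" using p by simp
  define q where "q = p / (p - 1)"
  define r where "r = norm z"
  have r: "0 \<le> r" "r < 1" "1 - r\<^sup>2 > 0" using z by (auto simp: r_def power_less_one_iff)
  have q: "q > 1" "1 / q + 1 / p = 1" "1 / q = 1 - 1 / p" using p by (auto simp: q_def diff_divide_distrib)
  let ?u = "\<lambda>t. norm (1 - z * cis (- t)) powr (- s)"
  have up: "?u t powr q = norm (1 - z * cis (- t)) powr (- (s * q))" for t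
    by (simp add: powr_powr)
  have "circle_mean (\<lambda>t. ?u t * norm (f (cis t))) \<le> 
        circle_mean (\<lambda>t. ?u t powr q) powr (1 / q) * circle_mean (\<lambda>t. norm (f (cis t)) powr p) powr (1 / p)"
    using p q measurable_circ_norm_powr[of "- z"] f continuous_on_norm_kernel_powr[OF z]
    by (intro Hoelder_circle_mean) (auto simp: Lp_circle_def up intro!: integrable_circ_continuous)
  also have "circle_mean (\<lambda>t. ?u t powr q) = (1 - r\<^sup>2) powr (1 - s * q) * power_mean (s * q - 2) r"
    unfolding up r_def by (rule circle_mean_kernel_power[OF z])
  also have "\<dots> powr (1 / q) = (1 - r\<^sup>2) powr ((1 - s * q) * (1 / q)) * power_mean (s * q - 2) r powr (1 / q)"
    by (simp add: powr_mult powr_powr)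
  also have "(1 - s * q) * (1 / q) = 1 - 1 / p - s"
    unfolding q(3)[symmetric] using q(1) by (simp add: field_simps)
  also have "power_mean (s * q - 2) r powr (1 / q) = extremal_factor s p r"
    unfolding extremal_factor_gt_1[OF p] q(3)[symmetric] by (simp only: q_def)
  finally show ?thesis by (simp add: r_def Lp_norm_eq)
qed

section \<open>Differentiation of the integral\<close>

text \<open>The z-derivative of \<open>K_kernel\<close>. In the term where the power of 1 - z is
  differentiated, 1 - |z|^2 is replaced by (1 - cnj z) + cnj z (1 - z). Both summands then have
  total degree -(\<alpha> + \<beta> + 2) in 1 - z and 1 - cnj z, and their coefficients are the
  source of |\<alpha> + 1| + |\<beta>| r.\<close>

definition dK :: "complex \<Rightarrow> complex \<Rightarrow> complex \<Rightarrow> complex" where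
  "dK \<alpha> \<beta> z = c_ab \<alpha> \<beta> * of_real (1 - (cmod z)\<^sup>2) powr (\<alpha> + \<beta>) *
     ((\<alpha> + 1) * (1 - z) powr (- \<alpha> - 2) * (1 - cnj z) powr (- \<beta>) -
      \<beta> * cnj z * (1 - z) powr (- \<alpha> - 1) * (1 - cnj z) powr (- \<beta> - 1))"

lemma disc_slit:
  assumes "norm z < 1"
  shows "1 - z \<notin> \<real>\<^sub>\<le>\<^sub>0" "1 - cnj z \<notin> \<real>\<^sub>\<le>\<^sub>0" "complex_of_real (1 - (cmod z)\<^sup>2) \<notin> \<real>\<^sub>\<le>\<^sub>0"
    and "0 \<le> Re (1 - z)" "0 \<le> Re (1 - cnj z)" "0 \<le> Re (complex_of_real (1 - (cmod z)\<^sup>2))"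
proof -
  have "Re z < 1" using assms complex_Re_le_cmod[of z] by linarith
  thus "0 \<le> Re (1 - z)" "0 \<le> Re (1 - cnj z)" by simp_all
  from \<open>Re z < 1\<close> show "1 - z \<notin> \<real>\<^sub>\<le>\<^sub>0" "1 - cnj z \<notin> \<real>\<^sub>\<le>\<^sub>0" by (auto simp: complex_nonpos_Reals_iff)
  have "(cmod z)\<^sup>2 < 1" using assms by (simp add: power_less_one_iff)
  thus "0 \<le> Re (complex_of_real (1 - (cmod z)\<^sup>2))" by simp
  from \<open>(cmod z)\<^sup>2 < 1\<close> show "complex_of_real (1 - (cmod z)\<^sup>2) \<notin> \<real>\<^sub>\<le>\<^sub>0"
    by (subst nonpos_Reals_of_real_iff) simp
qed

lemma powr_plus_one: "w \<noteq> 0 \<Longrightarrow> w powr (a + 1) = w powr a * (w :: complex)"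
  by (simp add: powr_add)

text \<open>The product rule along a line. The second term is the derivative with respect to cnj z:
  the kernel does not change when the parameters are exchanged and z is conjugated at the same time,
  so \<open>dK\<close> with exchanged parameters describes it.\<close>

lemma K_kernel_has_vector_derivative:
  fixes z u :: complex
  assumes z: "norm (z + of_real h * u) < 1"
  shows "((\<lambda>h. K_kernel \<alpha> \<beta> (z + of_real h * u)) has_vector_derivative
           (u * dK \<alpha> \<beta> (z + of_real h * u) + cnj u * dK \<beta> \<alpha> (cnj (z + of_real h * u)))) (at h)"
proof -
  define \<zeta> where "\<zeta> = z + of_real h * u"
  define A where "A = 1 - \<zeta> * cnj \<zeta>"
  define B where "B = 1 - \<zeta>"
  define C where "C = 1 - cnj \<zeta>"
  have \<zeta>: "norm \<zeta> < 1" using z by (simp add: \<zeta>_def)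
  have A_eq: "A = of_real (1 - (cmod \<zeta>)\<^sup>2)"
    by (simp add: A_def complex_norm_square del: of_real_power)
  note slit = disc_slit(1-3)[OF \<zeta>, folded A_eq B_def C_def]
  have nz: "A \<noteq> 0" "B \<noteq> 0" "C \<noteq> 0" using slit by auto
  have K: "K_kernel \<alpha> \<beta> w = c_ab \<alpha> \<beta> * ((1 - w * cnj w) powr (\<alpha> + \<beta> + 1) *
      ((1 - w) powr (- \<alpha> - 1) * (1 - cnj w) powr (- \<beta> - 1)))" for w
    by (simp add: K_kernel_def complex_norm_square powr_minus[of _ "_ + 1", simplified] divide_inverse del: of_real_power)
  have dw: "((\<lambda>h. z + of_real h * u) has_vector_derivative u) (at h)"
    by (auto simp: has_vector_derivative_def scaleR_conv_of_real intro!: derivative_eq_intros)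
  have dcw: "((\<lambda>h. cnj (z + of_real h * u)) has_vector_derivative cnj u) (at h)"
    by (rule has_vector_derivative_cnj[OF dw])
  have dA: "((\<lambda>h. 1 - (z + of_real h * u) * cnj (z + of_real h * u)) has_vector_derivative
      (0 - (\<zeta> * cnj u + u * cnj \<zeta>))) (at h)"
    unfolding \<zeta>_def
    by (intro has_vector_derivative_diff has_vector_derivative_const has_vector_derivative_mult dw dcw)
  have dB: "((\<lambda>h. 1 - (z + of_real h * u)) has_vector_derivative (0 - u)) (at h)"
    by (intro has_vector_derivative_diff has_vector_derivative_const dw)
  have dC: "((\<lambda>h. 1 - cnj (z + of_real h * u)) has_vector_derivative (0 - cnj u)) (at h)"
    by (intro has_vector_derivative_diff has_vector_derivative_const dcw)
  have pA: "((\<lambda>h. (1 - (z + of_real h * u) * cnj (z + of_real h * u)) powr a) has_vector_derivative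
       (0 - (\<zeta> * cnj u + u * cnj \<zeta>)) * (a * A powr (a - 1))) (at h)" for a
    using field_vector_diff_chain_at[OF dA, of "\<lambda>x. x powr a" "a * A powr (a - 1)"] slit(3)
    by (auto simp: o_def \<zeta>_def[symmetric] A_def[symmetric] intro: has_field_derivative_powr)
  have pB: "((\<lambda>h. (1 - (z + of_real h * u)) powr a) has_vector_derivative (0 - u) * (a * B powr (a - 1))) (at h)" for a
    using field_vector_diff_chain_at[OF dB, of "\<lambda>x. x powr a" "a * B powr (a - 1)"] slit(1)
    by (auto simp: o_def \<zeta>_def[symmetric] B_def[symmetric] intro: has_field_derivative_powr)
  have pC: "((\<lambda>h. (1 - cnj (z + of_real h * u)) powr a) has_vector_derivative (0 - cnj u) * (a * C powr (a - 1))) (at h)" for a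
    using field_vector_diff_chain_at[OF dC, of "\<lambda>x. x powr a" "a * C powr (a - 1)"] slit(2)
    by (auto simp: o_def \<zeta>_def[symmetric] C_def[symmetric] intro: has_field_derivative_powr)
  let ?D = "c_ab \<alpha> \<beta> * (A powr (\<alpha> + \<beta> + 1) * (B powr (- \<alpha> - 1) * ((0 - cnj u) * ((- \<beta> - 1) * C powr (- \<beta> - 1 - 1))) +
        (0 - u) * ((- \<alpha> - 1) * B powr (- \<alpha> - 1 - 1)) * C powr (- \<beta> - 1)) +
      (0 - (\<zeta> * cnj u + u * cnj \<zeta>)) * ((\<alpha> + \<beta> + 1) * A powr (\<alpha> + \<beta> + 1 - 1)) * (B powr (- \<alpha> - 1) * C powr (- \<beta> - 1)))"
  have D: "((\<lambda>h. K_kernel \<alpha> \<beta> (z + of_real h * u)) has_vector_derivative ?D) (at h)"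
    unfolding K
    using has_vector_derivative_mult_right[OF has_vector_derivative_mult[OF pA[of "\<alpha> + \<beta> + 1"]
       has_vector_derivative_mult[OF pB[of "- \<alpha> - 1"] pC[of "- \<beta> - 1"]]], of "c_ab \<alpha> \<beta>"]
    by (simp only: \<zeta>_def[symmetric] A_def[symmetric] B_def[symmetric] C_def[symmetric])
  \<comment> \<open>The lowest powers that occur. All others are these times powers of
    \<open>A\<close>, \<open>B\<close>, \<open>C\<close>, which reduces the claim to a polynomial
    identity.\<close>
  define P where "P = A powr (\<alpha> + \<beta>)"
  define X where "X = B powr (- \<alpha> - 2)"
  define Y where "Y = C powr (- \<beta> - 2)"
  have e: "- \<alpha> - 2 + 1 = - \<alpha> - 1" "- \<alpha> - 1 + 1 = - \<alpha>" "- \<beta> - 2 + 1 = - \<beta> - 1" "- \<beta> - 1 + 1 = - \<beta>"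
    by simp_all
  have pw: "A powr (\<alpha> + \<beta> + 1) = P * A" "A powr (\<beta> + \<alpha>) = P"
    "B powr (- \<alpha> - 1) = X * B" "B powr (- \<alpha>) = X * B * B" "C powr (- \<beta> - 1) = Y * C" "C powr (- \<beta>) = Y * C * C"
    using powr_plus_one[OF nz(1), of "\<alpha> + \<beta>"] powr_plus_one[OF nz(2), of "- \<alpha> - 2"] powr_plus_one[OF nz(2), of "- \<alpha> - 1"]
      powr_plus_one[OF nz(3), of "- \<beta> - 2"] powr_plus_one[OF nz(3), of "- \<beta> - 1"]
    unfolding e by (simp_all only: P_def X_def Y_def add.commute)
  have e: "- \<alpha> - 1 - 1 = - \<alpha> - 2" "- \<beta> - 1 - 1 = - \<beta> - 2" "\<alpha> + \<beta> + 1 - 1 = \<alpha> + \<beta>" by simp_all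
  have c: "c_ab \<beta> \<alpha> = c_ab \<alpha> \<beta>" by (simp add: c_ab_def add_ac mult_ac)
  have dKa: "dK \<alpha> \<beta> \<zeta> = c_ab \<alpha> \<beta> * P * ((\<alpha> + 1) * X * (Y * C * C) - \<beta> * cnj \<zeta> * (X * B) * (Y * C))"
    unfolding dK_def A_eq[symmetric] B_def[symmetric] C_def[symmetric] P_def[symmetric] X_def[symmetric] pw ..
  have dKb: "dK \<beta> \<alpha> (cnj \<zeta>) = c_ab \<alpha> \<beta> * P * ((\<beta> + 1) * Y * (X * B * B) - \<alpha> * \<zeta> * (Y * C) * (X * B))"
    unfolding dK_def complex_mod_cnj complex_cnj_cnj A_eq[symmetric] B_def[symmetric] C_def[symmetric] Y_def[symmetric] pw c ..
  have "?D = u * dK \<alpha> \<beta> \<zeta> + cnj u * dK \<beta> \<alpha> (cnj \<zeta>)"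
    unfolding dKa dKb e pw X_def[symmetric] Y_def[symmetric] P_def[symmetric]
    unfolding A_def B_def C_def by (simp add: algebra_simps)
  with D show ?thesis unfolding \<zeta>_def by simp
qed

lemma has_vector_derivative_iff_quotient:
  fixes F :: "real \<Rightarrow> 'a::real_normed_vector"
  shows "(F has_vector_derivative D) (at 0) \<longleftrightarrow> ((\<lambda>h. (1 / h) *\<^sub>R (F h - F 0)) \<longlongrightarrow> D) (at 0)"
proof -
  have "norm ((1 / h) *\<^sub>R (F h - F 0) - D) = norm (F h - F 0 - h *\<^sub>R D) / norm h" if "h \<noteq> 0" for h
  proof -
    have "(1 / h) *\<^sub>R (F h - F 0) - D = (1 / h) *\<^sub>R (F h - F 0 - h *\<^sub>R D)"
      using that by (simp add: scaleR_diff_right)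
    thus ?thesis by (simp only: norm_scaleR) (simp add: field_simps)
  qed
  hence "eventually (\<lambda>h. norm ((1 / h) *\<^sub>R (F h - F 0) - D) = norm (F h - F 0 - h *\<^sub>R D) / norm h) (at 0)"
    by (simp add: eventually_at_filter)
  note cong = tendsto_cong[OF this, of 0]
  have "((\<lambda>h. (1 / h) *\<^sub>R (F h - F 0)) \<longlongrightarrow> D) (at 0) \<longleftrightarrow>
        ((\<lambda>h. (1 / h) *\<^sub>R (F h - F 0) - D) \<longlongrightarrow> 0) (at 0)"
    by (rule LIM_zero_iff[symmetric])
  also have "\<dots> \<longleftrightarrow> ((\<lambda>h. norm ((1 / h) *\<^sub>R (F h - F 0) - D)) \<longlongrightarrow> 0) (at 0)"
    by (rule tendsto_norm_zero_iff[symmetric])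
  also have "\<dots> \<longleftrightarrow> ((\<lambda>h. norm (F h - F 0 - h *\<^sub>R D) / norm h) \<longlongrightarrow> 0) (at 0)"
    by (rule cong)
  also have "\<dots> \<longleftrightarrow> (F has_vector_derivative D) (at 0)"
    by (simp add: has_vector_derivative_def has_derivative_iff_norm bounded_linear_scaleR_left)
  finally show ?thesis ..
qed

text \<open>The mean value inequality bounds the difference quotients of \<open>G\<close> by
  \<open>M\<close>, so M |f| is an integrable majorant although \<open>f\<close> itself is merely
  integrable.\<close>

lemma has_vector_derivative_circ_integral:
  fixes G :: "real \<Rightarrow> real \<Rightarrow> complex"
  assumes d: "d > 0"
    and G: "\<And>h t. \<bar>h\<bar> < d \<Longrightarrow> ((\<lambda>h. G h t) has_vector_derivative G' h t) (at h)"
    and M: "\<And>h t. \<bar>h\<bar> < d \<Longrightarrow> norm (G' h t) \<le> M"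
    and meas: "\<And>h. \<bar>h\<bar> < d \<Longrightarrow> continuous_on {0..2*pi} (G h)" "continuous_on {0..2*pi} (G' 0)"
    and f: "integrable circ f"
  shows "((\<lambda>h. LINT t|circ. G h t * f t) has_vector_derivative (LINT t|circ. G' 0 t * f t)) (at 0)"
unfolding has_vector_derivative_iff_quotient
proof -
  have M0: "M \<ge> 0" using order_trans[OF norm_ge_zero M[of 0 0]] d by simp
  have contm: "k \<in> borel_measurable circ" if "continuous_on {0..2*pi} k" for k :: "real \<Rightarrow> complex"
    using borel_measurable_integrable[OF integrable_circ_continuous[OF that]] .
  have bdd: "norm (G h t - G 0 t) \<le> M * \<bar>h\<bar>" if h: "\<bar>h\<bar> < d" for h t
  proof -
    have "norm (G h t - G 0 t) \<le> M * norm (h - 0)"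
    proof (rule differentiable_bound)
      show "convex {-d<..<d}" by simp
      show "((\<lambda>h. G h t) has_derivative (\<lambda>x. x *\<^sub>R G' h t)) (at h within {-d<..<d})" if "h \<in> {-d<..<d}" for h
        using G[of h t] that by (auto simp: has_vector_derivative_def abs_less_iff intro: has_derivative_at_withinI)
      show "onorm (\<lambda>x. x *\<^sub>R G' h t) \<le> M" if "h \<in> {-d<..<d}" for h
      proof (rule onorm_le)
        fix x :: real
        have "\<bar>x\<bar> * norm (G' h t) \<le> \<bar>x\<bar> * M" using that by (intro mult_left_mono M) auto
        thus "norm (x *\<^sub>R G' h t) \<le> M * norm x" by (simp add: mult.commute)
      qed
    qed (use h d in \<open>auto simp: abs_less_iff\<close>)
    thus ?thesis by simp
  qed
  have int: "integrable circ (\<lambda>t. G h t * f t)" if "\<bar>h\<bar> < d" for h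
    using meas(1)[OF that] f by (rule integrable_circ_mult)
  show "((\<lambda>h. (1 / h) *\<^sub>R ((LINT t|circ. G h t * f t) - (LINT t|circ. G 0 t * f t))) \<longlongrightarrow> (LINT t|circ. G' 0 t * f t)) (at 0)"
  proof (subst tendsto_at_iff_sequentially, intro allI impI)
    fix X :: "nat \<Rightarrow> real" assume X: "\<forall>i. X i \<in> UNIV - {0}" "X \<longlonglongrightarrow> 0"
    \<comment> \<open>The bounds hold only for |h| < d, hence the shift of the sequence by
      \<open>N\<close>.\<close>
    have "eventually (\<lambda>n. \<bar>X n\<bar> < d) sequentially"
      using X(2) d by (auto simp: tendsto_iff dist_norm)
    then obtain N where N: "\<And>n. n \<ge> N \<Longrightarrow> \<bar>X n\<bar> < d" by (auto simp: eventually_sequentially)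
    have "(\<lambda>n. LINT t|circ. (1 / X (n + N)) *\<^sub>R (G (X (n + N)) t - G 0 t) * f t) \<longlonglongrightarrow> (LINT t|circ. G' 0 t * f t)"
    proof (rule integral_dominated_convergence)
      show "integrable circ (\<lambda>t. M * norm (f t))" using f by simp
      show "(\<lambda>t. G' 0 t * f t) \<in> borel_measurable circ" using contm[OF meas(2)] f by simp
      show "(\<lambda>t. (1 / X (n + N)) *\<^sub>R (G (X (n + N)) t - G 0 t) * f t) \<in> borel_measurable circ" for n
        using contm[OF meas(1)[OF N[of "n + N"]]] contm[OF meas(1)[of 0]] d f by simp
      show "AE t in circ. (\<lambda>n. (1 / X (n + N)) *\<^sub>R (G (X (n + N)) t - G 0 t) * f t) \<longlonglongrightarrow> G' 0 t * f t"
      proof (rule AE_I2)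
        fix t
        have "((\<lambda>h. (1 / h) *\<^sub>R (G h t - G 0 t)) \<longlongrightarrow> G' 0 t) (at 0)"
          using G[of 0 t] d by (simp add: has_vector_derivative_iff_quotient)
        from tendsto_at_iff_sequentially[THEN iffD1, OF this] X
        have "(\<lambda>n. (1 / X n) *\<^sub>R (G (X n) t - G 0 t)) \<longlonglongrightarrow> G' 0 t" by (auto simp: o_def)
        from LIMSEQ_ignore_initial_segment[OF this, of N]
        show "(\<lambda>n. (1 / X (n + N)) *\<^sub>R (G (X (n + N)) t - G 0 t) * f t) \<longlonglongrightarrow> G' 0 t * f t"
          by (intro tendsto_mult tendsto_const)
      qed
      fix n
      show "AE t in circ. norm ((1 / X (n + N)) *\<^sub>R (G (X (n + N)) t - G 0 t) * f t) \<le> M * norm (f t)"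
      proof (rule AE_I2)
        fix t
        have "X (n + N) \<noteq> 0" using X by auto
        moreover have "norm ((1 / X (n + N)) *\<^sub>R (G (X (n + N)) t - G 0 t)) = norm (G (X (n + N)) t - G 0 t) / \<bar>X (n + N)\<bar>"
          by (simp only: norm_scaleR) simp
        ultimately have "norm ((1 / X (n + N)) *\<^sub>R (G (X (n + N)) t - G 0 t)) \<le> M"
          using bdd[OF N[of "n + N"], of t] by (simp add: pos_divide_le_eq)
        thus "norm ((1 / X (n + N)) *\<^sub>R (G (X (n + N)) t - G 0 t) * f t) \<le> M * norm (f t)"
          unfolding norm_mult by (rule mult_right_mono) simp
      qed
    qed
    moreover have "(LINT t|circ. (1 / X (n + N)) *\<^sub>R (G (X (n + N)) t - G 0 t) * f t) = 
       (1 / X (n + N)) *\<^sub>R ((LINT t|circ. G (X (n + N)) t * f t) - (LINT t|circ. G 0 t * f t))" for n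
      using int[of 0] int[OF N[of "n + N"]] d
      by (subst Bochner_Integration.integral_diff[symmetric])
         (simp_all add: left_diff_distrib)
    ultimately have "(\<lambda>n. (1 / X (n + N)) *\<^sub>R ((LINT t|circ. G (X (n + N)) t * f t) - (LINT t|circ. G 0 t * f t)))
        \<longlonglongrightarrow> (LINT t|circ. G' 0 t * f t)" by (simp only:)
    thus "((\<lambda>h. (1 / h) *\<^sub>R ((LINT t|circ. G h t * f t) - (LINT t|circ. G 0 t * f t))) \<circ> X) \<longlonglongrightarrow> (LINT t|circ. G' 0 t * f t)"
      unfolding o_def by (rule LIMSEQ_offset)
  qed
qed

text \<open>The parameters may vary as well: constant ones give bounds on compact discs, variable
  ones the continuity at (0, 0). Continuity of \<open>c_ab\<close> stays a hypothesis because it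
  depends on the position of the poles of Gamma.\<close>

lemma continuous_on_dK:
  assumes "\<And>x. x \<in> S \<Longrightarrow> norm (g x) < 1" "continuous_on S a" "continuous_on S b" "continuous_on S g"
    and "continuous_on S (\<lambda>x. c_ab (a x) (b x))"
  shows "continuous_on S (\<lambda>x. dK (a x) (b x) (g x))"
proof -
  have "S \<subseteq> {x. 0 \<le> Re (1 - g x) \<or> Im (1 - g x) \<noteq> 0}"
       "S \<subseteq> {x. 0 \<le> Re (1 - cnj (g x)) \<or> Im (1 - cnj (g x)) \<noteq> 0}"
       "S \<subseteq> {x. 0 \<le> Re (complex_of_real (1 - (cmod (g x))\<^sup>2)) \<or> Im (complex_of_real (1 - (cmod (g x))\<^sup>2)) \<noteq> 0}"
    using disc_slit(4-6)[OF assms(1)] by blast+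
  moreover have "1 - g x \<noteq> 0" "1 - cnj (g x) \<noteq> 0" "complex_of_real (1 - (cmod (g x))\<^sup>2) \<noteq> 0" if "x \<in> S" for x
    using disc_slit(1-3)[OF assms(1)[OF that]] by auto
  ultimately show ?thesis unfolding dK_def
    by (intro continuous_intros continuous_on_powr_complex assms(2-)) auto
qed

lemma K_int_has_directional_derivative:
  assumes f: "f \<in> Lp_circle p" "p \<ge> 1" and z: "norm z < 1"
  shows "((\<lambda>h. K_int \<alpha> \<beta> f (z + of_real h * v)) has_vector_derivative
          v * circle_mean (\<lambda>t. cis (- t) * dK \<alpha> \<beta> (z * cis (- t)) * f (cis t)) +
          cnj v * circle_mean (\<lambda>t. cis t * dK \<beta> \<alpha> (cnj (z * cis (- t))) * f (cis t))) (at 0)"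
proof -
  note int = Lp_circle_integrable[OF f]
  \<comment> \<open>For |h| < d the points z + h v stay in the closed disc of radius \<rho> < 1, a
    compact set on which the kernel derivatives are bounded uniformly in t. The 1 in the denominator
    of \<open>d\<close> allows v = 0.\<close>
  define \<rho> where "\<rho> = (1 + norm z) / 2"
  have \<rho>: "norm z < \<rho>" "\<rho> < 1" using z by (auto simp: \<rho>_def)
  define d where "d = (\<rho> - norm z) / (1 + norm v)"
  have d: "d > 0" using \<rho> by (simp add: d_def add_pos_nonneg)
  have in_ball: "norm (z + of_real h * v) \<le> \<rho>" if "\<bar>h\<bar> < d" for h
  proof -
    have "\<bar>h\<bar> * norm v \<le> d * (1 + norm v)" using that by (intro mult_mono) auto
    also have "\<dots> = \<rho> - norm z" unfolding d_def by (simp add: add_pos_nonneg less_imp_neq[THEN not_sym])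
    finally have "norm (of_real h * v) \<le> \<rho> - norm z" by (simp add: norm_mult)
    thus ?thesis using norm_triangle_ineq[of z "of_real h * v"] by linarith
  qed
  have cont: "continuous_on (cball 0 \<rho>) (dK a b)" for a b
    using continuous_on_dK[of "cball 0 \<rho>" "\<lambda>z. z" "\<lambda>_. a" "\<lambda>_. b"] \<rho> by (simp add: continuous_on_id)
  have "\<exists>B. \<forall>w\<in>cball 0 \<rho>. norm (dK a b w) \<le> B" for a b
  proof -
    have "bounded (dK a b ` cball 0 \<rho>)"
      by (intro compact_imp_bounded compact_continuous_image cont) auto
    thus ?thesis unfolding bounded_iff by blast
  qed
  then obtain B where B: "\<And>a b w. norm w \<le> \<rho> \<Longrightarrow> norm (dK a b w) \<le> B a b"
    by (metis dist_0_norm mem_cball)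
  \<comment> \<open>The rotation is absorbed into base point and direction, so \<open>W\<close> is
    affine in h and the derivative of the kernel applies in direction v cis(-t).\<close>
  define W where "W h t = z * cis (- t) + of_real h * (v * cis (- t))" for h t
  have W: "W h t = (z + of_real h * v) * cis (- t)" for h t by (simp add: W_def algebra_simps)
  have normW: "norm (W h t) = norm (z + of_real h * v)" for h t by (simp add: W norm_mult)
  define G' where "G' h t = v * cis (- t) * dK \<alpha> \<beta> (W h t) + cnj (v * cis (- t)) * dK \<beta> \<alpha> (cnj (W h t))" for h t
  have contW: "continuous_on S (W h)" for S h unfolding W by (intro continuous_intros)
  have cdK: "continuous_on {0..2*pi} (\<lambda>t. dK a b (W h t))" "continuous_on {0..2*pi} (\<lambda>t. dK a b (cnj (W h t)))"
    if "\<bar>h\<bar> < d" for h a b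
    using in_ball[OF that] \<rho> by (auto intro!: continuous_on_dK continuous_intros contW simp: normW)
  have "((\<lambda>h. LINT t|circ. K_kernel \<alpha> \<beta> (W h t) * f (cis t)) has_vector_derivative (LINT t|circ. G' 0 t * f (cis t))) (at 0)"
  proof (rule has_vector_derivative_circ_integral[OF d _ _ _ _ int])
    fix h t assume h: "\<bar>h\<bar> < d"
    show "((\<lambda>h. K_kernel \<alpha> \<beta> (W h t)) has_vector_derivative G' h t) (at h)"
      unfolding G'_def W_def
      using in_ball[OF h] \<rho> normW[of h t] by (intro K_kernel_has_vector_derivative) (simp add: W_def)
    have "norm (G' h t) \<le> norm v * B \<alpha> \<beta> + norm v * B \<beta> \<alpha>"
      unfolding G'_def using in_ball[OF h] 
      by (intro norm_triangle_le add_mono) (auto simp: norm_mult normW intro!: mult_left_mono B)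
    thus "norm (G' h t) \<le> norm v * B \<alpha> \<beta> + norm v * B \<beta> \<alpha>" .
  next
    fix h assume h: "\<bar>h\<bar> < d"
    have n: "norm (W h t) < 1" for t using in_ball[OF h] \<rho> by (simp add: normW)
    have nz: "1 - W h t \<noteq> 0" "1 - cnj (W h t) \<noteq> 0" "complex_of_real (1 - (cmod (W h t))\<^sup>2) \<noteq> 0" for t
      using disc_slit(1-3)[OF n[of t]] by auto
    have sub: "S \<subseteq> {t. 0 \<le> Re (1 - W h t) \<or> Im (1 - W h t) \<noteq> 0}"
       "S \<subseteq> {t. 0 \<le> Re (1 - cnj (W h t)) \<or> Im (1 - cnj (W h t)) \<noteq> 0}"
       "S \<subseteq> {t. 0 \<le> Re (complex_of_real (1 - (cmod (W h t))\<^sup>2)) \<or> Im (complex_of_real (1 - (cmod (W h t))\<^sup>2)) \<noteq> 0}" for S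
      using disc_slit(4-6)[OF n] by blast+
    show "continuous_on {0..2*pi} (\<lambda>t. K_kernel \<alpha> \<beta> (W h t))"
      unfolding K_kernel_def using nz sub
      by (intro continuous_intros continuous_on_powr_complex contW) auto
  next
    show "continuous_on {0..2*pi} (G' 0)"
      unfolding G'_def using d by (intro continuous_intros cdK) auto
  qed
  also have "(\<lambda>h. LINT t|circ. K_kernel \<alpha> \<beta> (W h t) * f (cis t)) = 
     (\<lambda>h. LINT t|circ. K_kernel \<alpha> \<beta> ((z + of_real h * v) * cis (- t)) * f (cis t))"
    unfolding W ..
  finally have D: "((\<lambda>h. K_int \<alpha> \<beta> f (z + of_real h * v)) has_vector_derivative 
      of_real (1 / (2 * pi)) * (LINT t|circ. G' 0 t * f (cis t))) (at 0)"
    unfolding K_int_def by (rule has_vector_derivative_mult_right)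
  have "(LINT t|circ. G' 0 t * f (cis t)) =
        (LINT t|circ. v * (cis (- t) * dK \<alpha> \<beta> (z * cis (- t)) * f (cis t)) +
                      cnj v * (cis t * dK \<beta> \<alpha> (cnj (z * cis (- t))) * f (cis t)))"
    by (intro Bochner_Integration.integral_cong) (simp_all add: G'_def W cis_cnj algebra_simps)
  also have "\<dots> = v * (LINT t|circ. cis (- t) * dK \<alpha> \<beta> (z * cis (- t)) * f (cis t)) +
                  cnj v * (LINT t|circ. cis t * dK \<beta> \<alpha> (cnj (z * cis (- t))) * f (cis t))"
    using d cdK[of 0 \<alpha> \<beta>] cdK[of 0 \<beta> \<alpha>]
    by (subst Bochner_Integration.integral_add)
       (auto intro!: integrable_mult_right integrable_circ_mult int continuous_intros simp: W)
  finally show ?thesis using D by (simp add: circle_mean_def scaleR_conv_of_real algebra_simps)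
qed

text \<open>The directional derivatives in the directions 1 and i are combined; the part that is
  conjugate-linear in the direction cancels.\<close>

lemma K_int_wirtinger:
  assumes f: "f \<in> Lp_circle p" "p \<ge> 1" and z: "norm z < 1"
  shows "(\<lambda>h::real. K_int \<alpha> \<beta> f (z + of_real h)) differentiable at 0"
    and "(\<lambda>h::real. K_int \<alpha> \<beta> f (z + \<i> * of_real h)) differentiable at 0"
    and "wirtinger (K_int \<alpha> \<beta> f) z = circle_mean (\<lambda>t. cis (- t) * dK \<alpha> \<beta> (z * cis (- t)) * f (cis t))"
proof -
  note D = K_int_has_directional_derivative[OF assms, of \<alpha> \<beta>]
  note D1 = D[of 1, simplified] and Di = D[of \<i>, simplified, unfolded mult.commute[of _ \<i>]]
  show "(\<lambda>h::real. K_int \<alpha> \<beta> f (z + of_real h)) differentiable at 0"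
    using D1 by (rule differentiableI_vector)
  show "(\<lambda>h::real. K_int \<alpha> \<beta> f (z + \<i> * of_real h)) differentiable at 0"
    using Di by (rule differentiableI_vector)
  show "wirtinger (K_int \<alpha> \<beta> f) z = circle_mean (\<lambda>t. cis (- t) * dK \<alpha> \<beta> (z * cis (- t)) * f (cis t))"
    unfolding wirtinger_def pd_x_def pd_y_def vector_derivative_at[OF D1] vector_derivative_at[OF Di]
    by (simp add: algebra_simps)
qed

section \<open>The growth estimate\<close>

text \<open>The arguments of 1 - z and 1 - cnj z are opposite, so the modulus carries the factor exp
  (- Im (a - b) Arg (1 - z)), and Re (1 - z) > 0 confines the argument to at most pi/2. This is the
  origin of the exponential in the growth bound.\<close>

lemma norm_kernel_powr:
  assumes z: "norm z < 1"
  shows "norm ((1 - z) powr a * (1 - cnj z) powr b) \<le>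
         exp (pi / 2 * \<bar>Im (a - b)\<bar>) * norm (1 - z) powr (Re (a + b))"
proof -
  note s = disc_slit[OF z]
  have nz: "1 - z \<noteq> 0" "1 - cnj z \<noteq> 0" using s(1,2) by auto
  have "Re (1 - z) > 0" using complex_Re_le_cmod[of z] z by simp
  hence Arg: "\<bar>Arg (1 - z)\<bar> \<le> pi / 2"
    using nz(1) Re_Ln_pos_lt[of "1 - z"] by (simp add: Arg_eq_Im_Ln)
  have "Ln (1 - cnj z) = cnj (Ln (1 - z))" using cnj_Ln[OF s(1)] by simp
  hence cnj: "Arg (1 - cnj z) = - Arg (1 - z)" using nz by (simp add: Arg_eq_Im_Ln)
  have n: "norm (1 - cnj z) = norm (1 - z)" by (metis complex_cnj_diff complex_cnj_one complex_mod_cnj)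
  have "norm ((1 - z) powr a * (1 - cnj z) powr b) =
        norm (1 - z) powr (Re (a + b)) * exp (- Im (a - b) * Arg (1 - z))"
    by (simp add: norm_mult norm_powr_complex cnj n powr_add algebra_simps flip: exp_add)
  also have "\<dots> \<le> norm (1 - z) powr (Re (a + b)) * exp (pi / 2 * \<bar>Im (a - b)\<bar>)"
  proof -
    have "- Im (a - b) * Arg (1 - z) \<le> \<bar>Im (a - b)\<bar> * \<bar>Arg (1 - z)\<bar>"
      by (metis abs_ge_self abs_minus abs_mult)
    also have "\<dots> \<le> \<bar>Im (a - b)\<bar> * (pi / 2)" using Arg by (intro mult_left_mono) auto
    finally show ?thesis by (intro mult_left_mono) (auto simp: mult_ac)
  qed
  finally show ?thesis by (simp add: mult_ac)
qed

lemma norm_dK_le: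
  assumes z: "norm z < 1"
  shows "norm (dK \<alpha> \<beta> z) \<le> norm (c_ab \<alpha> \<beta>) * (norm (\<alpha> + 1) + norm \<beta> * norm z) *
           exp (pi / 2 * \<bar>Im (\<alpha> - \<beta>)\<bar>) * (1 - (norm z)\<^sup>2) powr Re (\<alpha> + \<beta>) *
           norm (1 - z) powr (- (Re (\<alpha> + \<beta>) + 2))"
proof -
  let ?E = "exp (pi / 2 * \<bar>Im (\<alpha> - \<beta>)\<bar>) * norm (1 - z) powr (- (Re (\<alpha> + \<beta>) + 2))"
  have r: "0 \<le> 1 - (norm z)\<^sup>2" using z by (simp add: power_le_one)
  \<comment> \<open>The two products of powers have the same sum of exponents, and their differences
    of exponents agree up to a real number, so the single bound \<open>?E\<close> serves
    both.\<close>
  have *: "\<bar>Im (- \<alpha> - 2 - - \<beta>)\<bar> = \<bar>Im (\<alpha> - \<beta>)\<bar>" "Re (- \<alpha> - 2 + - \<beta>) = - (Re (\<alpha> + \<beta>) + 2)"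
    "\<bar>Im (- \<alpha> - 1 - (- \<beta> - 1))\<bar> = \<bar>Im (\<alpha> - \<beta>)\<bar>" "Re (- \<alpha> - 1 + (- \<beta> - 1)) = - (Re (\<alpha> + \<beta>) + 2)"
    by (auto simp: abs_if)
  have 1: "norm ((\<alpha> + 1) * (1 - z) powr (- \<alpha> - 2) * (1 - cnj z) powr (- \<beta>)) \<le> norm (\<alpha> + 1) * ?E"
    using norm_kernel_powr[OF z, of "- \<alpha> - 2" "- \<beta>"] unfolding *
    by (simp add: norm_mult mult.assoc mult_left_mono)
  have 2: "norm (\<beta> * cnj z * (1 - z) powr (- \<alpha> - 1) * (1 - cnj z) powr (- \<beta> - 1)) \<le> norm \<beta> * norm z * ?E"
    using norm_kernel_powr[OF z, of "- \<alpha> - 1" "- \<beta> - 1"] unfolding *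
    by (simp add: norm_mult mult.assoc mult_left_mono)
  have "norm ((\<alpha> + 1) * (1 - z) powr (- \<alpha> - 2) * (1 - cnj z) powr (- \<beta>) -
      \<beta> * cnj z * (1 - z) powr (- \<alpha> - 1) * (1 - cnj z) powr (- \<beta> - 1)) \<le> (norm (\<alpha> + 1) + norm \<beta> * norm z) * ?E"
    using order_trans[OF norm_triangle_ineq4 add_mono[OF 1 2]] by (simp only: distrib_right[of "norm (\<alpha> + 1)"])
  hence "norm (c_ab \<alpha> \<beta>) * (1 - (norm z)\<^sup>2) powr Re (\<alpha> + \<beta>) * norm ((\<alpha> + 1) * (1 - z) powr (- \<alpha> - 2) * (1 - cnj z) powr (- \<beta>) -
      \<beta> * cnj z * (1 - z) powr (- \<alpha> - 1) * (1 - cnj z) powr (- \<beta> - 1)) \<le>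
      norm (c_ab \<alpha> \<beta>) * (1 - (norm z)\<^sup>2) powr Re (\<alpha> + \<beta>) * ((norm (\<alpha> + 1) + norm \<beta> * norm z) * ?E)"
    by (intro mult_left_mono) auto
  moreover have "norm (complex_of_real (1 - (norm z)\<^sup>2) powr (\<alpha> + \<beta>)) = (1 - (norm z)\<^sup>2) powr Re (\<alpha> + \<beta>)"
    by (subst norm_powr_real_powr) (use r in auto)
  ultimately show ?thesis unfolding dK_def norm_mult[of "_ * _ powr (\<alpha> + \<beta>)"] norm_mult[of "c_ab \<alpha> \<beta>"]
    by (simp only: mult_ac)
qed

lemma circle_mean_norm_le:
  fixes h :: "real \<Rightarrow> complex"
  assumes "integrable circ k" "\<And>t. norm (h t) \<le> k t"
  shows "norm (circle_mean h) \<le> circle_mean k"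
proof (cases "integrable circ h")
  case True
  have "norm (circle_mean h) \<le> circle_mean (\<lambda>t. norm (h t))"
    by (simp add: circle_mean_def divide_right_mono)
  also have "\<dots> \<le> circle_mean k" using assms True by (intro circle_mean_mono) auto
  finally show ?thesis .
next
  case False
  \<comment> \<open>The integral of a non-integrable function is 0 by convention, so nonnegativity
    of the right side is enough.\<close>
  have "0 \<le> circle_mean k" using assms(2) by (intro circle_mean_nonneg) (metis norm_ge_zero order_trans)
  thus ?thesis using False by (simp add: circle_mean_def not_integrable_integral_eq)
qed

lemma kernel_mean_integrable:
  assumes "norm z < 1" "f \<in> Lp_circle p" "p \<ge> 1"
  shows "integrable circ (\<lambda>t. norm (1 - z * cis (- t)) powr m * norm (f (cis t)))"
  using Lp_circle_integrable[OF assms(2,3)]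
  by (intro integrable_circ_mult continuous_on_norm_kernel_powr[OF assms(1)] integrable_norm)

lemma wirtinger_bound:
  assumes f: "f \<in> Lp_circle p" "p \<ge> 1" and z: "norm z < 1" and ab: "Re (\<alpha> + \<beta>) > -1"
  shows "cmod (wirtinger (K_int \<alpha> \<beta> f) z) \<le> growth_bound p \<alpha> \<beta> f (norm z) (C_fun \<alpha> \<beta> p (norm z))"
proof -
  define r where "r = norm z"
  have r: "0 \<le> r" "r < 1" "1 - r\<^sup>2 > 0" using z by (auto simp: r_def power_less_one_iff)
  define s where "s = Re (\<alpha> + \<beta>) + 2"
  have s: "s > 0" using ab by (simp add: s_def)
  define Q where "Q = norm (c_ab \<alpha> \<beta>) * (norm (\<alpha> + 1) + norm \<beta> * r) *
           exp (pi / 2 * \<bar>Im (\<alpha> - \<beta>)\<bar>) * (1 - r\<^sup>2) powr (s - 2)"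
  have Q: "Q \<ge> 0" using r by (simp add: Q_def)
  have "norm (circle_mean (\<lambda>t. cis (- t) * dK \<alpha> \<beta> (z * cis (- t)) * f (cis t))) \<le>
        circle_mean (\<lambda>t. Q * (norm (1 - z * cis (- t)) powr (- s) * norm (f (cis t))))"
  proof (rule circle_mean_norm_le)
    show "integrable circ (\<lambda>t. Q * (norm (1 - z * cis (- t)) powr (- s) * norm (f (cis t))))"
      by (intro integrable_mult_right kernel_mean_integrable[OF z f])
    fix t
    have "norm (dK \<alpha> \<beta> (z * cis (- t))) \<le> Q * norm (1 - z * cis (- t)) powr (- s)"
      using norm_dK_le[of "z * cis (- t)" \<alpha> \<beta>] z by (simp add: norm_mult Q_def s_def r_def)
    thus "norm (cis (- t) * dK \<alpha> \<beta> (z * cis (- t)) * f (cis t)) \<le>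
            Q * (norm (1 - z * cis (- t)) powr (- s) * norm (f (cis t)))"
      by (simp add: norm_mult mult_right_mono flip: mult.assoc)
  qed
  also have "\<dots> = Q * circle_mean (\<lambda>t. norm (1 - z * cis (- t)) powr (- s) * norm (f (cis t)))"
    by (simp add: circle_mean_def)
  also have "\<dots> \<le> Q * ((1 - r\<^sup>2) powr (1 - 1 / p - s) * extremal_factor s p r * Lp_norm p f)"
    unfolding r_def by (intro mult_left_mono kernel_mean_bound z f s Q)
  also have "\<dots> = growth_bound p \<alpha> \<beta> f r (C_fun \<alpha> \<beta> p r)"
  proof -
    \<comment> \<open>Here s cancels: (s - 2) + (1 - 1/p - s) = -(1 + 1/p).\<close>
    have "(1 - r\<^sup>2) powr (s - 2) * (1 - r\<^sup>2) powr (1 - 1 / p - s) = inverse ((1 - r\<^sup>2) powr (1 + 1 / p))"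
      by (simp flip: powr_add powr_minus)
    moreover have "growth_bound p \<alpha> \<beta> f r (C_fun \<alpha> \<beta> p r) = norm (c_ab \<alpha> \<beta>) * (norm (\<alpha> + 1) + norm \<beta> * r) *
           exp (pi / 2 * \<bar>Im (\<alpha> - \<beta>)\<bar>) * inverse ((1 - r\<^sup>2) powr (1 + 1 / p)) * extremal_factor s p r * Lp_norm p f"
      by (simp only: growth_bound_def C_fun_def F1_eq[OF r(1,2)] s_def divide_inverse mult_ac)
    ultimately show ?thesis by (simp add: Q_def mult_ac)
  qed
  finally show ?thesis using K_int_wirtinger(3)[OF f z, of \<alpha> \<beta>] by (simp add: r_def)
qed

lemma growth_bound_mono:
  "C \<le> D \<Longrightarrow> growth_bound p \<alpha> \<beta> f r C \<le> growth_bound p \<alpha> \<beta> f r D"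
  unfolding growth_bound_def by (intro mult_right_mono divide_right_mono Lp_norm_nonneg) auto

lemma C_fun_le_C_const:
  assumes "Re (\<alpha> + \<beta>) > -1" "p \<ge> 1" "0 \<le> r" "r < 1"
  shows "C_fun \<alpha> \<beta> p r \<le> C_const p \<alpha> \<beta>"
proof -
  have s: "Re (\<alpha> + \<beta>) + 2 > 1" using assms by simp
  show ?thesis
    unfolding C_fun_def C_const_def F1_eq[OF assms(3,4)] Gamma_factor_eq[OF assms(1,2)]
    using assms s extremal_factor_nonneg[of "Re (\<alpha> + \<beta>) + 2" p r] extremal_factor_le_one[OF s assms(2-4)]
    by (intro mult_mono) (auto intro: mult_left_le)
qed

section \<open>Locality and conjugation symmetry of the Wirtinger derivatives\<close>

lemma wirtinger_cong:
  assumes "\<And>\<zeta>. \<zeta> \<in> ball 0 1 \<Longrightarrow> w \<zeta> = v \<zeta>" "norm z < 1"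
  shows "wirtinger w z = wirtinger v z" "wirtinger_bar w z = wirtinger_bar v z"
proof -
  \<comment> \<open>A line through z stays in the disc near parameter 0, where both functions agree;
    the partial derivatives see nothing else.\<close>
  have "eventually (\<lambda>t. w (g t) = v (g t)) (nhds (0::real))" if "isCont g 0" "g 0 = z" for g :: "real \<Rightarrow> complex"
  proof -
    have "(g \<longlongrightarrow> z) (nhds 0)" using that tendsto_at_iff_tendsto_nhds[of g 0] by (simp add: isCont_def)
    hence "eventually (\<lambda>t. g t \<in> ball 0 1) (nhds 0)" using assms(2) by (intro topological_tendstoD) auto
    thus ?thesis by eventually_elim (rule assms(1))
  qed
  hence "eventually (\<lambda>t. w (z + of_real t) = v (z + of_real t)) (nhds (0::real))"
    "eventually (\<lambda>t. w (z + \<i> * of_real t) = v (z + \<i> * of_real t)) (nhds (0::real))" by auto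
  hence "pd_x w z = pd_x v z" "pd_y w z = pd_y v z"
    unfolding pd_x_def pd_y_def by (auto intro!: vector_derivative_cong_eq elim: eventually_mono)
  thus "wirtinger w z = wirtinger v z" "wirtinger_bar w z = wirtinger_bar v z"
    by (simp_all add: wirtinger_def wirtinger_bar_def)
qed

text \<open>Conjugating \<^const>\<open>K_int\<close> exchanges \<open>\<alpha>\<close> and \<open>\<beta>\<close>; this reduces the claims about
  \<^const>\<open>wirtinger_bar\<close> to those about \<^const>\<open>wirtinger\<close>.\<close>

lemma cnj_c_ab: "cnj (c_ab \<alpha> \<beta>) = c_ab (cnj \<beta>) (cnj \<alpha>)"
  by (simp add: c_ab_def cnj_Gamma mult.commute add_ac)

lemma cnj_K_kernel:
  assumes "norm z < 1"
  shows "cnj (K_kernel \<alpha> \<beta> z) = K_kernel (cnj \<beta>) (cnj \<alpha>) z"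
proof -
  note s = disc_slit[OF assms]
  have "cnj (of_real (1 - (cmod z)\<^sup>2) powr (\<alpha> + \<beta> + 1)) = of_real (1 - (cmod z)\<^sup>2) powr (cnj \<beta> + cnj \<alpha> + 1)"
    using s(6) by (subst cnj_powr) (simp_all add: add_ac)
  moreover have "cnj ((1 - z) powr (\<alpha> + 1)) = (1 - cnj z) powr (cnj \<alpha> + 1)"
    using s(4) by (subst cnj_powr) simp_all
  moreover have "cnj ((1 - cnj z) powr (\<beta> + 1)) = (1 - z) powr (cnj \<beta> + 1)"
    using s(5) by (subst cnj_powr) simp_all
  ultimately show ?thesis by (simp add: K_kernel_def cnj_c_ab mult.commute)
qed

lemma cnj_K_int:
  assumes "norm z < 1"
  shows "cnj (K_int \<alpha> \<beta> f z) = K_int (cnj \<beta>) (cnj \<alpha>) (cnj \<circ> f) z"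
proof -
  have "cnj (K_kernel \<alpha> \<beta> (z * cis (- t)) * f (cis t)) = K_kernel (cnj \<beta>) (cnj \<alpha>) (z * cis (- t)) * (cnj \<circ> f) (cis t)" for t
    using assms by (simp add: cnj_K_kernel norm_mult)
  thus ?thesis
    unfolding K_int_def complex_cnj_mult complex_cnj_complex_of_real
    by (simp only: Bochner_Integration.integral_cnj[symmetric] complex_cnj_mult)
qed

lemma cnj_Lp_circle_iff: "cnj \<circ> f \<in> Lp_circle p \<longleftrightarrow> f \<in> Lp_circle p"
proof -
  have "(\<lambda>t. cnj (g t)) \<in> borel_measurable circ" if "g \<in> borel_measurable circ" for g
    by (rule measurable_compose[OF that])
       (intro borel_measurable_continuous_onI continuous_on_cnj continuous_on_id)
  note m = this[of "\<lambda>t. f (cis t)"] this[of "\<lambda>t. cnj (f (cis t))", unfolded complex_cnj_cnj]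
  have "(\<lambda>t. cnj (f (cis t))) \<in> borel_measurable circ \<longleftrightarrow> (\<lambda>t. f (cis t)) \<in> borel_measurable circ"
    using m by (intro iffI)
  thus ?thesis by (simp only: Lp_circle_def mem_Collect_eq o_def complex_mod_cnj)
qed

lemma growth_bound_cnj:
  "growth_bound p (cnj \<beta>) (cnj \<alpha>) (cnj \<circ> f) r C = growth_bound p \<alpha> \<beta> f r C"
  by (simp add: growth_bound_def Lp_norm_def)

lemma wirtinger_bar_K_int:
  assumes f: "f \<in> Lp_circle p" "p \<ge> 1" and z: "norm z < 1"
  shows "wirtinger_bar (K_int \<alpha> \<beta> f) z = cnj (wirtinger (K_int (cnj \<beta>) (cnj \<alpha>) (cnj \<circ> f)) z)"
proof -
  have "wirtinger (K_int (cnj \<beta>) (cnj \<alpha>) (cnj \<circ> f)) z = wirtinger (\<lambda>z. cnj (K_int \<alpha> \<beta> f z)) z"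
    using z by (intro wirtinger_cong) (auto simp: cnj_K_int)
  also have "\<dots> = cnj (wirtinger_bar (K_int \<alpha> \<beta> f) z)"
    unfolding wirtinger_def wirtinger_bar_def pd_x_def pd_y_def
    using K_int_wirtinger(1,2)[OF assms, of \<alpha> \<beta>] by (simp add: vector_derivative_cnj)
  finally show ?thesis by simp
qed

text \<open>Conjugation f -> cnj f maps L^p onto itself and preserves the norm, so both infima are
  taken over the same set of constants.\<close>

lemma best_const_wirtinger_bar:
  assumes "p \<ge> 1"
  shows "best_const wirtinger_bar p \<alpha> \<beta> = best_const wirtinger p (cnj \<beta>) (cnj \<alpha>)"
proof -
  have "(\<forall>f\<in>Lp_circle p. \<forall>z\<in>ball 0 1. cmod (wirtinger_bar (K_int \<alpha> \<beta> f) z) \<le> growth_bound p \<alpha> \<beta> f (cmod z) C) \<longleftrightarrow>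
        (\<forall>f\<in>Lp_circle p. \<forall>z\<in>ball 0 1. cmod (wirtinger (K_int (cnj \<beta>) (cnj \<alpha>) f) z) \<le> growth_bound p (cnj \<beta>) (cnj \<alpha>) f (cmod z) C)"
    (is "?L = ?R") for C
  proof
    assume L: ?L
    show ?R
    proof (intro ballI)
      fix f z assume fz: "f \<in> Lp_circle p" "z \<in> ball (0::complex) 1"
      define g where "g = cnj \<circ> f"
      have g: "g \<in> Lp_circle p" "cnj \<circ> g = f"
        using fz(1) unfolding g_def cnj_Lp_circle_iff by (auto simp: o_def)
      show "cmod (wirtinger (K_int (cnj \<beta>) (cnj \<alpha>) f) z) \<le> growth_bound p (cnj \<beta>) (cnj \<alpha>) f (cmod z) C"
        using L[rule_format, OF g(1) fz(2)] fz(2) wirtinger_bar_K_int[OF g(1) assms, of z \<alpha> \<beta>]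
          growth_bound_cnj[of p \<beta> \<alpha> g "cmod z" C] unfolding g(2) by simp
    qed
  next
    assume R: ?R
    show ?L
    proof (intro ballI)
      fix f z assume fz: "f \<in> Lp_circle p" "z \<in> ball (0::complex) 1"
      have "cnj \<circ> f \<in> Lp_circle p" using fz(1) by (simp add: cnj_Lp_circle_iff)
      from R[rule_format, OF this fz(2)] show "cmod (wirtinger_bar (K_int \<alpha> \<beta> f) z) \<le> growth_bound p \<alpha> \<beta> f (cmod z) C"
        using fz(2) wirtinger_bar_K_int[OF fz(1) assms, of z \<alpha> \<beta>] growth_bound_cnj[of p \<beta> \<alpha> f "cmod z" C] by simp
    qed
  qed
  thus ?thesis by (simp add: best_const_def)
qed

lemma norm_cnj_plus_one: "norm (cnj w + 1) = norm (w + 1)"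
  by (metis complex_cnj_add complex_cnj_one complex_mod_cnj)

lemma D_eq_C_cnj:
  "D_const p \<alpha> \<beta> = C_const p (cnj \<beta>) (cnj \<alpha>)" "D_fun \<alpha> \<beta> p r = C_fun (cnj \<beta>) (cnj \<alpha>) p r"
proof -
  have "cmod (c_ab (cnj \<beta>) (cnj \<alpha>)) = cmod (c_ab \<alpha> \<beta>)" by (metis cnj_c_ab complex_mod_cnj)
  moreover have "F1 (cnj \<beta>) (cnj \<alpha>) = F1 \<alpha> \<beta>" "Gamma_factor (cnj \<beta>) (cnj \<alpha>) = Gamma_factor \<alpha> \<beta>"
    by (auto simp: fun_eq_iff F1_def Gamma_factor_def add.commute)
  ultimately show "D_const p \<alpha> \<beta> = C_const p (cnj \<beta>) (cnj \<alpha>)" "D_fun \<alpha> \<beta> p r = C_fun (cnj \<beta>) (cnj \<alpha>) p r"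
    by (simp_all add: D_const_def C_const_def D_fun_def C_fun_def norm_cnj_plus_one)
qed

section \<open>Asymptotic sharpness\<close>

definition admissible :: "real \<Rightarrow> complex \<Rightarrow> complex \<Rightarrow> real set" where
  "admissible p \<alpha> \<beta> = {C. \<forall>f\<in>Lp_circle p. \<forall>z\<in>ball 0 1.
      cmod (wirtinger (K_int \<alpha> \<beta> f) z) \<le> growth_bound p \<alpha> \<beta> f (cmod z) C}"

lemma best_const_eq: "best_const wirtinger p \<alpha> \<beta> = Inf (admissible p \<alpha> \<beta>)"
  by (simp add: best_const_def admissible_def)

lemma C_const_admissible:
  assumes "Re (\<alpha> + \<beta>) > -1" "p \<ge> 1"
  shows "C_const p \<alpha> \<beta> \<in> admissible p \<alpha> \<beta>"
  unfolding admissible_def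
proof (intro CollectI ballI)
  fix f and z :: complex assume "f \<in> Lp_circle p" "z \<in> ball 0 1"
  thus "cmod (wirtinger (K_int \<alpha> \<beta> f) z) \<le> growth_bound p \<alpha> \<beta> f (cmod z) (C_const p \<alpha> \<beta>)"
    using wirtinger_bound[of f p z \<alpha> \<beta>] growth_bound_mono[OF C_fun_le_C_const[of \<alpha> \<beta> p "cmod z"]] assms
    by (meson mem_ball_0 norm_ge_zero order_trans)
qed

lemma admissible_ge:
  assumes f: "f \<in> Lp_circle p" and z: "norm z < 1" and N: "Lp_norm p f > 0" and C: "C \<in> admissible p \<alpha> \<beta>"
  shows "cmod (wirtinger (K_int \<alpha> \<beta> f) z) * (1 - (norm z)\<^sup>2) powr (1 + 1 / p) /
           (exp (pi / 2 * \<bar>Im (\<alpha> - \<beta>)\<bar>) * Lp_norm p f) \<le> C"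
proof -
  have "(1 - (norm z)\<^sup>2) > 0" using z by (simp add: power_less_one_iff)
  hence pos: "(1 - (norm z)\<^sup>2) powr (1 + 1 / p) > 0" by simp
  have "cmod (wirtinger (K_int \<alpha> \<beta> f) z) \<le> growth_bound p \<alpha> \<beta> f (cmod z) C"
    using C f z by (auto simp: admissible_def)
  hence "cmod (wirtinger (K_int \<alpha> \<beta> f) z) * (1 - (norm z)\<^sup>2) powr (1 + 1 / p) \<le>
     C * (exp (pi / 2 * \<bar>Im (\<alpha> - \<beta>)\<bar>) * Lp_norm p f)"
    using pos by (simp add: growth_bound_def pos_le_divide_eq mult_ac)
  thus ?thesis using N by (simp add: pos_divide_le_eq)
qed

lemma Lp_circle_continuous:
  assumes "continuous_on {0..2*pi} (\<lambda>t. f (cis t))" "p \<ge> 1"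
  shows "f \<in> Lp_circle p"
proof -
  have "continuous_on {0..2*pi} (\<lambda>t. cmod (f (cis t)) powr p)"
    using assms by (intro continuous_on_powr' continuous_intros) auto
  from integrable_circ_continuous[OF this] integrable_circ_continuous[OF assms(1)] show ?thesis
    by (auto simp: Lp_circle_def)
qed

lemma best_const_le_C_const:
  assumes "Re (\<alpha> + \<beta>) > -1" "p \<ge> 1"
  shows "best_const wirtinger p \<alpha> \<beta> \<le> C_const p \<alpha> \<beta>"
  unfolding best_const_eq
proof (rule cInf_lower[OF C_const_admissible[OF assms]])
  have one: "(\<lambda>_. 1) \<in> Lp_circle p" using assms by (intro Lp_circle_continuous continuous_intros)
  have N: "Lp_norm p (\<lambda>_. 1) = 1" by (simp add: Lp_norm_eq circle_mean_const)
  \<comment> \<open>f = 1 and z = 0 force every admissible constant to be nonnegative; for a set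
    without lower bound \<open>Inf\<close> would carry no information.\<close>
  show "bdd_below (admissible p \<alpha> \<beta>)"
  proof (rule bdd_belowI)
    fix C assume "C \<in> admissible p \<alpha> \<beta>"
    from admissible_ge[OF one _ _ this, of 0] N show "0 \<le> C"
      by (simp add: order_trans[rotated])
  qed
qed

text \<open>Each test function and point bounds all admissible constants from below. The set of
  these constants contains \<open>C_const\<close>, so the bound passes to its infimum.\<close>

lemma best_const_ge:
  assumes f: "f \<in> Lp_circle p" and z: "norm z < 1" and N: "Lp_norm p f > 0" and ab: "Re (\<alpha> + \<beta>) > -1" "p \<ge> 1"
  shows "cmod (wirtinger (K_int \<alpha> \<beta> f) z) * (1 - (norm z)\<^sup>2) powr (1 + 1 / p) /
           (exp (pi / 2 * \<bar>Im (\<alpha> - \<beta>)\<bar>) * Lp_norm p f) \<le> best_const wirtinger p \<alpha> \<beta>"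
  unfolding best_const_eq using C_const_admissible[OF ab] admissible_ge[OF f z N]
  by (intro cInf_greatest) auto

section \<open>Continuity in the parameters near the origin\<close>

abbreviation nhd0 :: "(complex \<times> complex) set" where "nhd0 \<equiv> ball 0 (1/2) \<times> ball 0 (1/2)"

lemma nhd0: "open nhd0" "(0, 0) \<in> nhd0"
  by (auto intro: open_Times)

text \<open>The radius 1/2 is chosen for this: \<alpha> + 1, \<beta> + 1 and \<alpha> + \<beta> + 1
  stay in the right half-plane, away from the poles of Gamma.\<close>

lemma nhd0_Re:
  assumes "x \<in> nhd0"
  shows "Re (fst x) > -1/2" "Re (snd x) > -1/2" "Re (fst x + snd x) > -1"
proof -
  have "\<bar>Re (fst x)\<bar> < 1/2" "\<bar>Re (snd x)\<bar> < 1/2"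
    using assms abs_Re_le_cmod[of "fst x"] abs_Re_le_cmod[of "snd x"] by (auto simp: mem_Times_iff)
  thus "Re (fst x) > -1/2" "Re (snd x) > -1/2" "Re (fst x + snd x) > -1" by auto
qed

lemma Re_pos_not_nonpos_Int: "Re z > 0 \<Longrightarrow> z \<notin> \<int>\<^sub>\<le>\<^sub>0"
  by (auto elim!: nonpos_Ints_cases)

lemma continuous_on_c_ab: "continuous_on nhd0 (\<lambda>x. c_ab (fst x) (snd x))"
proof -
  have G: "continuous_on nhd0 (\<lambda>x. Gamma (g x))"
    if "continuous_on nhd0 g" "\<And>x. x \<in> nhd0 \<Longrightarrow> Re (g x) > 0" for g :: "complex \<times> complex \<Rightarrow> complex"
    by (rule continuous_on_compose2[OF continuous_on_Gamma that(1), of "{z. Re z > 0}"])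
       (use that(2) Re_pos_not_nonpos_Int in auto)
  show ?thesis unfolding c_ab_def
  proof (intro continuous_on_divide continuous_on_mult G)
    show "\<forall>x\<in>nhd0. Gamma (fst x + snd x + 1) \<noteq> 0"
    proof
      fix x assume "x \<in> nhd0"
      hence "Re (fst x + snd x + 1) > 0" using nhd0_Re(3) by fastforce
      thus "Gamma (fst x + snd x + 1) \<noteq> 0" using Re_pos_not_nonpos_Int by (metis Gamma_eq_zero_iff)
    qed
  qed (use nhd0_Re in \<open>fastforce intro!: continuous_intros\<close>)+
qed

lemma c_ab_0: "c_ab 0 0 = 1"
  by (simp add: c_ab_def)

text \<open>For a continuous test function the integrand is jointly continuous in the parameters and
  t, and t runs over a compact interval.\<close>

lemma wirtinger_continuous_params:
  assumes f: "continuous_on {0..2*pi} (\<lambda>t. f (cis t))" and z: "norm z < 1"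
  shows "continuous_on nhd0 (\<lambda>x. wirtinger (K_int (fst x) (snd x) f) z)"
proof -
  let ?g = "\<lambda>x t. cis (- t) * dK (fst x) (snd x) (z * cis (- t)) * f (cis t)"
  have c: "continuous_on (nhd0 \<times> cbox 0 (2*pi)) (\<lambda>(x, t). ?g x t)"
    unfolding case_prod_unfold
  proof (intro continuous_on_mult)
    show "continuous_on (nhd0 \<times> cbox 0 (2*pi)) (\<lambda>x. dK (fst (fst x)) (snd (fst x)) (z * cis (- snd x)))"
    proof (intro continuous_on_dK)
      show "continuous_on (nhd0 \<times> cbox 0 (2*pi)) (\<lambda>x. c_ab (fst (fst x)) (snd (fst x)))"
        by (rule continuous_on_compose2[OF continuous_on_c_ab]) (auto intro!: continuous_intros)
    qed (use z in \<open>auto intro!: continuous_intros simp: norm_mult\<close>)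
    show "continuous_on (nhd0 \<times> cbox 0 (2*pi)) (\<lambda>x. f (cis (snd x)))"
      by (rule continuous_on_compose2[OF f]) (auto intro!: continuous_intros)
  qed (intro continuous_intros)
  have "continuous_on nhd0 (\<lambda>x. integral (cbox 0 (2*pi)) (?g x))"
    using c by (rule integral_continuous_on_param)
  moreover have "wirtinger (K_int (fst x) (snd x) f) z = (1 / (2*pi)) *\<^sub>R integral (cbox 0 (2*pi)) (?g x)"
    if "x \<in> nhd0" for x
  proof -
    have "continuous_on {0..2*pi} (?g x)"
    proof -
      have "continuous_on {0..2*pi} (\<lambda>t. (x, t))" by (intro continuous_intros)
      moreover have "(\<lambda>t. (x, t)) ` {0..2*pi} \<subseteq> nhd0 \<times> cbox 0 (2*pi)" using that by auto
      ultimately show ?thesis using continuous_on_compose2[OF c] by fastforce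
    qed
    thus ?thesis
      using K_int_wirtinger(3)[OF Lp_circle_continuous[OF f order_refl] order_refl z]
      by (simp add: circle_mean_def integral_circ_continuous)
  qed
  ultimately show ?thesis by (auto intro!: continuous_intros cong: continuous_on_cong)
qed

lemma isCont_tendsto_nhds: "isCont g a \<Longrightarrow> (g \<longlongrightarrow> g a) (nhds a)"
  unfolding isCont_def tendsto_at_iff_tendsto_nhds .

lemma best_const_lower_semicontinuous:
  assumes f: "continuous_on {0..2*pi} (\<lambda>t. f (cis t))" and z: "norm z < 1" and N: "Lp_norm p f > 0" and p: "p \<ge> 1"
    and a: "a < cmod (wirtinger (K_int 0 0 f) z) * (1 - (norm z)\<^sup>2) powr (1 + 1 / p) / Lp_norm p f"
  shows "eventually (\<lambda>x. a < best_const wirtinger p (fst x) (snd x)) (nhds (0, 0))"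
proof -
  let ?R = "\<lambda>x. cmod (wirtinger (K_int (fst x) (snd x) f) z) * (1 - (norm z)\<^sup>2) powr (1 + 1 / p) /
           (exp (pi / 2 * \<bar>Im (fst x - snd x)\<bar>) * Lp_norm p f)"
  have "continuous_on nhd0 ?R" using N
    by (intro continuous_intros wirtinger_continuous_params f z) auto
  hence "isCont ?R (0, 0)" using nhd0 continuous_on_eq_continuous_at by blast
  hence "(?R \<longlongrightarrow> ?R (0, 0)) (nhds (0, 0))" by (rule isCont_tendsto_nhds)
  moreover have "a < ?R (0, 0)" using a by simp
  ultimately have "eventually (\<lambda>x. a < ?R x) (nhds (0, 0))" by (rule order_tendstoD)
  moreover have "eventually (\<lambda>x. x \<in> nhd0) (nhds (0, 0))" using nhd0 by (intro eventually_nhds_in_open)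
  ultimately show ?thesis
  proof eventually_elim
    fix x assume x: "a < ?R x" "x \<in> nhd0"
    show "a < best_const wirtinger p (fst x) (snd x)"
      using x(1) best_const_ge[OF Lp_circle_continuous[OF f p] z N nhd0_Re(3)[OF x(2)] p] by (rule less_le_trans)
  qed
qed

text \<open>The equality case of the Hoelder inequality for the kernel \<^term>\<open>dK 0 0\<close> at \<open>z = r\<close>. For
  \<open>p = 1\<close> there is no extremal function; these functions are then only optimal as \<open>q \<rightarrow> \<infinity>\<close>.\<close>

definition extremal :: "real \<Rightarrow> real \<Rightarrow> complex \<Rightarrow> complex" where
  "extremal q r u = u * (1 - of_real r * cnj u)\<^sup>2 * of_real (cmod (1 - of_real r * cnj u) powr (- 2 * q))"

lemma dK_0: "norm z < 1 \<Longrightarrow> dK 0 0 z = 1 / (1 - z)\<^sup>2"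
proof -
  assume z: "norm z < 1"
  note s = disc_slit[OF z]
  have "1 - z \<noteq> 0" "1 - cnj z \<noteq> 0" "complex_of_real (1 - (cmod z)\<^sup>2) \<noteq> 0" using s(1-3) by auto
  moreover from this have "(1 - z) powr (- 2) = 1 / (1 - z)\<^sup>2"
    by (simp add: powr_minus divide_inverse)
  ultimately show ?thesis by (simp add: dK_def c_ab_0)
qed

text \<open>With k = cis(-t) / (1 - r cis(-t))^2, the kernel of the derivative at \<alpha> = \<beta>
  = 0, the function \<open>extremal\<close> is cnj k * |k|^(q - 2). Hence its product with k is
  |k|^q and its modulus is |k|^(q - 1).\<close>

lemma extremal_properties:
  assumes r: "0 \<le> r" "r < 1"
  shows "continuous_on {0..2*pi} (\<lambda>t. extremal q r (cis t))"
    and "cmod (extremal q r (cis t)) = norm (1 - of_real r * cis (- t)) powr (2 - 2 * q)"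
    and "wirtinger (K_int 0 0 (extremal q r)) (of_real r) = of_real (circle_mean (\<lambda>t. norm (1 - of_real r * cis (- t)) powr (- (2 * q))))"
proof -
  let ?w = "\<lambda>t. 1 - complex_of_real r * cis (- t)"
  have nr: "norm (complex_of_real r) < 1" using r by simp
  have nz: "?w t \<noteq> 0" for t using one_minus_neq_0[OF nr] by blast
  have ext: "extremal q r (cis t) = cis t * (?w t)\<^sup>2 * of_real (norm (?w t) powr (- 2 * q))" for t
    by (simp add: extremal_def cis_cnj)
  show c: "continuous_on {0..2*pi} (\<lambda>t. extremal q r (cis t))"
    unfolding ext using nz by (intro continuous_intros) auto
  show "cmod (extremal q r (cis t)) = norm (?w t) powr (2 - 2 * q)"
    using nz[of t] powr_add[of "norm (?w t)" 2 "- 2 * q"]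
    by (simp add: ext norm_mult norm_power)
  have "cis (- t) * dK 0 0 (of_real r * cis (- t)) * extremal q r (cis t) = of_real (norm (?w t) powr (- (2 * q)))" for t
  proof -
    have "dK 0 0 (of_real r * cis (- t)) = 1 / (?w t)\<^sup>2" using r by (intro dK_0) (simp add: norm_mult)
    moreover have "cis (- t) * cis t = 1" by (simp add: cis_mult)
    ultimately show ?thesis using nz[of t] unfolding ext by (simp add: field_simps)
  qed
  thus "wirtinger (K_int 0 0 (extremal q r)) (of_real r) = of_real (circle_mean (\<lambda>t. norm (?w t) powr (- (2 * q))))"
    using K_int_wirtinger(3)[OF Lp_circle_continuous[OF c order_refl] order_refl nr, of 0 0]
    by (simp add: circle_mean_def scaleR_conv_of_real)
qed

text \<open>Serves to make the norms of the extremal functions and their pairings with the kernel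
  strictly positive.\<close>

lemma power_mean_pos_kernel:
  assumes r: "0 \<le> r" "r < 1" and q: "q > 0"
  shows "circle_mean (\<lambda>t. norm (1 - of_real r * cis (- t)) powr (- (2 * q))) \<ge> (1 + r) powr (- (2 * q))"
proof -
  have nr: "norm (complex_of_real r) < 1" using r by simp
  have "circle_mean (\<lambda>_. (1 + r) powr (- (2 * q))) \<le> circle_mean (\<lambda>t. norm (1 - of_real r * cis (- t)) powr (- (2 * q)))"
  proof (intro circle_mean_mono integrable_circ_continuous continuous_on_norm_kernel_powr[OF nr] continuous_on_const)
    fix t
    have "norm (1 - of_real r * cis (- t)) \<le> 1 + r"
      using norm_triangle_ineq4[of 1 "of_real r * cis (- t)"] r by (simp add: norm_mult)
    moreover have "norm (1 - of_real r * cis (- t)) > 0" using one_minus_neq_0[OF nr] by simp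
    ultimately show "(1 + r) powr (- (2 * q)) \<le> norm (1 - of_real r * cis (- t)) powr (- (2 * q))"
      using q by (intro powr_mono2') auto
  qed
  thus ?thesis by (simp add: circle_mean_const)
qed

text \<open>The pairing with the kernel equals \<open>J\<close>. If p is conjugate to q, the norm is
  J powr (1 - 1/q); for p = 1, Hoelder against the constant 1 gives the same expression as an upper
  bound. Either way the quotient is at least J powr (1/q). For p = 1 the powers of 1 - r^2 do not
  match exactly and leave (1 - r^2) powr (1/q).\<close>

lemma extremal_ratio:
  assumes r: "0 \<le> r" "r < 1" and q: "q > 1" and p: "p \<ge> 1" "p = 1 \<or> p = q / (q - 1)"
  shows "Lp_norm p (extremal q r) > 0"
    and "(1 - r\<^sup>2) powr (1 / q + 1 / p - 1) * power_mean (2 * q - 2) r powr (1 / q) \<le>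
         cmod (wirtinger (K_int 0 0 (extremal q r)) (of_real r)) * (1 - r\<^sup>2) powr (1 + 1 / p) / Lp_norm p (extremal q r)"
proof -
  let ?w = "\<lambda>t. norm (1 - complex_of_real r * cis (- t))"
  define J where "J = circle_mean (\<lambda>t. ?w t powr (- (2 * q)))"
  have nr: "norm (complex_of_real r) < 1" using r by simp
  have r2: "1 - r\<^sup>2 > 0" using r by (simp add: power_less_one_iff)
  have Jpos: "J > 0" 
    using power_mean_pos_kernel[OF r, of q] q r unfolding J_def by (intro less_le_trans[OF _ power_mean_pos_kernel]) auto
  have N: "Lp_norm p (extremal q r) = circle_mean (\<lambda>t. ?w t powr (- (2 * ((q - 1) * p)))) powr (1 / p)"
    unfolding Lp_norm_eq extremal_properties(2)[OF r] powr_powr by (simp add: algebra_simps)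
  have "circle_mean (\<lambda>t. ?w t powr (- (2 * ((q - 1) * p)))) > 0"
    using q p r by (intro less_le_trans[OF _ power_mean_pos_kernel[OF r]]) auto
  thus Npos: "Lp_norm p (extremal q r) > 0" unfolding N by simp
  have N_le: "Lp_norm p (extremal q r) \<le> J powr (1 - 1 / q)"
  proof (cases "p = 1")
    case True
    \<comment> \<open>For p = 1 the norm is the mean of |k|^(q - 1); the exponent q / (q - 1) raises
      this to |k|^q, whose mean is \<open>J\<close>.\<close>
    define q' where "q' = q / (q - 1)"
    have q': "q' > 1" "1 / q' + 1 / q = 1" "1 / q' = 1 - 1 / q" using q by (auto simp: q'_def field_simps)
    have up: "(?w t powr (- (2 * (q - 1)))) powr q' = ?w t powr (- (2 * q))" for t
    proof -
      have "(q - 1) * q' = q" using q by (simp add: q'_def)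
      hence "- (2 * (q - 1)) * q' = - (2 * q)" by (simp only: mult_minus_left mult.assoc)
      thus ?thesis by (simp only: powr_powr)
    qed
    have "circle_mean (\<lambda>t. ?w t powr (- (2 * (q - 1))) * 1) \<le> 
       circle_mean (\<lambda>t. (?w t powr (- (2 * (q - 1)))) powr q') powr (1 / q') * circle_mean (\<lambda>t. 1 powr q) powr (1 / q)"
    proof (rule Hoelder_circle_mean[OF q'(1) q q'(2)])
      show "(\<lambda>t. ?w t powr (- (2 * (q - 1)))) \<in> borel_measurable circ"
        using measurable_circ_norm_powr[of "- of_real r"] by simp
      show "integrable circ (\<lambda>t. (?w t powr (- (2 * (q - 1)))) powr q')"
        unfolding up by (intro integrable_circ_continuous continuous_on_norm_kernel_powr[OF nr])
    qed (auto intro!: integrable_circ_continuous)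
    also have "\<dots> = J powr (1 - 1 / q)"
      unfolding up q'(3) by (simp add: J_def circle_mean_const)
    finally show ?thesis using True Npos unfolding N by (simp add: circle_mean_nonneg)
  next
    case False
    hence "p = q / (q - 1)" using p by simp
    hence "(q - 1) * p = q" "1 / p = 1 - 1 / q" using q by (simp_all add: diff_divide_distrib)
    thus ?thesis unfolding N by (simp add: J_def)
  qed
  have J_eq: "J = (1 - r\<^sup>2) powr (1 - 2 * q) * power_mean (2 * q - 2) r"
    unfolding J_def using circle_mean_kernel_power[OF nr, of "2 * q"] r by simp
  have "(1 - r\<^sup>2) powr (1 / q + 1 / p - 1) * power_mean (2 * q - 2) r powr (1 / q) = J powr (1 / q) * (1 - r\<^sup>2) powr (1 + 1 / p)"
  proof -
    have e1: "J powr (1 / q) = (1 - r\<^sup>2) powr ((1 - 2 * q) * (1 / q)) * power_mean (2 * q - 2) r powr (1 / q)"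
      unfolding J_eq by (simp add: powr_mult powr_powr)
    have e2: "(1 - r\<^sup>2) powr ((1 - 2 * q) * (1 / q)) * (1 - r\<^sup>2) powr (1 + 1 / p) = (1 - r\<^sup>2) powr (1 / q + 1 / p - 1)"
      using q by (simp add: field_simps flip: powr_add)
    show ?thesis unfolding e1 e2[symmetric] by (simp only: mult_ac)
  qed
  also have "J powr (1 / q) = J / J powr (1 - 1 / q)"
    using Jpos by (simp add: powr_diff)
  also have "J / J powr (1 - 1 / q) * (1 - r\<^sup>2) powr (1 + 1 / p) \<le> J / Lp_norm p (extremal q r) * (1 - r\<^sup>2) powr (1 + 1 / p)"
    using N_le Npos Jpos by (intro mult_right_mono divide_left_mono) auto
  also have "J = cmod (wirtinger (K_int 0 0 (extremal q r)) (of_real r))"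
    unfolding extremal_properties(3)[OF r] using Jpos by (simp add: J_def)
  finally show "(1 - r\<^sup>2) powr (1 / q + 1 / p - 1) * power_mean (2 * q - 2) r powr (1 / q) \<le>
         cmod (wirtinger (K_int 0 0 (extremal q r)) (of_real r)) * (1 - r\<^sup>2) powr (1 + 1 / p) / Lp_norm p (extremal q r)"
    by simp
qed

text \<open>The order of choices matters: r is fixed first, close to 1. For p = 1 the exponent q is
  chosen afterwards, since (1 - r^2) powr (1/q) tends to 1 as q grows with r fixed, but not as r ->
  1 with q fixed.\<close>

lemma best_const_eventually_gt:
  assumes p: "p \<ge> 1" and a: "a < extremal_factor 2 p 1"
  shows "eventually (\<lambda>x. a < best_const wirtinger p (fst x) (snd x)) (nhds (0, 0))"
proof -
  have "eventually (\<lambda>r. a < extremal_factor 2 p r) (at_left 1)"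
    using extremal_factor_tendsto_one[of 2 p] p a by (intro order_tendstoD) auto
  moreover have "eventually (\<lambda>r::real. r \<in> {0<..<1}) (at_left 1)" by (intro eventually_at_left_real) auto
  ultimately have "eventually (\<lambda>r. a < extremal_factor 2 p r \<and> 0 < r \<and> r < 1) (at_left 1)"
    by eventually_elim auto
  then obtain r where r: "a < extremal_factor 2 p r" "0 \<le> r" "r < 1"
    by (auto dest!: eventually_happens)
  have r2: "1 - r\<^sup>2 > 0" using r by (simp add: power_less_one_iff)
  have "\<exists>q>1. (p = 1 \<or> p = q / (q - 1)) \<and> a < (1 - r\<^sup>2) powr (1 / q + 1 / p - 1) * power_mean (2 * q - 2) r powr (1 / q)"
  proof (cases "p = 1")
    case True
    have inv: "((\<lambda>q::real. 1 / q) \<longlongrightarrow> 0) at_top"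
      by (intro tendsto_divide_0[OF tendsto_const] filterlim_at_top_imp_at_infinity filterlim_ident)
    have "((\<lambda>q. (1 - r\<^sup>2) powr (1 / q) * power_mean (2 * q - 2) r powr (1 / q)) \<longlongrightarrow> (1 - r\<^sup>2) powr 0 * (1 + r) powr 2) at_top"
      using r r2 by (intro tendsto_mult tendsto_powr tendsto_const inv power_mean_limit) auto
    moreover have "(1 - r\<^sup>2) powr 0 * (1 + r) powr 2 = extremal_factor 2 p r"
      using True r r2 by (simp add: extremal_factor_1)
    ultimately have "eventually (\<lambda>q. a < (1 - r\<^sup>2) powr (1 / q) * power_mean (2 * q - 2) r powr (1 / q)) at_top"
      using r(1) by (intro order_tendstoD) auto
    moreover have "eventually (\<lambda>q::real. q > 1) at_top" by (rule eventually_gt_at_top)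
    ultimately have "eventually (\<lambda>q. q > 1 \<and> a < (1 - r\<^sup>2) powr (1 / q) * power_mean (2 * q - 2) r powr (1 / q)) at_top"
      by eventually_elim auto
    then obtain q where "q > 1" "a < (1 - r\<^sup>2) powr (1 / q) * power_mean (2 * q - 2) r powr (1 / q)"
      by (auto dest!: eventually_happens)
    thus ?thesis using True by auto
  next
    case False
    hence p1: "p > 1" using p by simp
    define q where "q = p / (p - 1)"
    have q: "q > 1" "p = q / (q - 1)" "1 / q = 1 - 1 / p" using p1 by (auto simp: q_def field_simps)
    have "a < power_mean (2 * q - 2) r powr (1 / q)"
      using r(1) unfolding extremal_factor_gt_1[OF p1] q(3) by (simp add: q_def)
    moreover have "1 / q + 1 / p - 1 = 0" using q(3) by simp
    ultimately have "a < (1 - r\<^sup>2) powr (1 / q + 1 / p - 1) * power_mean (2 * q - 2) r powr (1 / q)"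
      using r2 by simp
    thus ?thesis using q(1,2) by blast
  qed
  then obtain q where q: "q > 1" "p = 1 \<or> p = q / (q - 1)"
    and aq: "a < (1 - r\<^sup>2) powr (1 / q + 1 / p - 1) * power_mean (2 * q - 2) r powr (1 / q)" by blast
  show ?thesis
  proof (rule best_const_lower_semicontinuous)
    show "continuous_on {0..2*pi} (\<lambda>t. extremal q r (cis t))" by (rule extremal_properties(1)[OF r(2,3)])
    show "Lp_norm p (extremal q r) > 0" by (rule extremal_ratio(1)[OF r(2,3) q(1) p q(2)])
    show "a < cmod (wirtinger (K_int 0 0 (extremal q r)) (of_real r)) * (1 - (norm (complex_of_real r))\<^sup>2) powr (1 + 1 / p) / Lp_norm p (extremal q r)"
      using less_le_trans[OF aq extremal_ratio(2)[OF r(2,3) q(1) p q(2)]] r by simp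
  qed (use r p in auto)
qed

section \<open>Limits of the constants at the origin\<close>

lemma C_const_tendsto:
  assumes p: "p \<ge> 1"
  shows "((\<lambda>x. C_const p (fst x) (snd x)) \<longlongrightarrow> extremal_factor 2 p 1) (nhds (0, 0))"
proof -
  let ?C = "\<lambda>x. cmod (c_ab (fst x) (snd x)) * (cmod (fst x + 1) + cmod (snd x)) * extremal_factor (Re (fst x + snd x) + 2) p 1"
  have "isCont ?C (0, 0)"
  proof (intro continuous_intros)
    show "isCont (\<lambda>x. c_ab (fst x) (snd x)) (0, 0)"
      using continuous_on_c_ab nhd0 continuous_on_eq_continuous_at by blast
    show "isCont (\<lambda>x. extremal_factor (Re (fst x + snd x) + 2) p 1) (0 :: complex, 0)"
      by (rule isCont_o2[where g = "\<lambda>s. extremal_factor s p 1"])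
         (auto intro!: continuous_intros extremal_factor_isCont p)
  qed
  hence "(?C \<longlongrightarrow> ?C (0, 0)) (nhds (0, 0))" by (rule isCont_tendsto_nhds)
  moreover have "?C (0, 0) = extremal_factor 2 p 1" by (simp add: c_ab_0)
  moreover have "eventually (\<lambda>x. ?C x = C_const p (fst x) (snd x)) (nhds (0, 0))"
  proof -
    have "eventually (\<lambda>x. x \<in> nhd0) (nhds (0, 0))" using nhd0 by (intro eventually_nhds_in_open)
    thus ?thesis
      by eventually_elim (simp add: C_const_def Gamma_factor_eq[OF nhd0_Re(3) p])
  qed
  ultimately show ?thesis by (simp only: tendsto_cong[symmetric])
qed

lemma C_const_asymptotically_sharp:
  assumes p: "p \<ge> 1"
  shows "asymptotically_sharp (C_const p) (best_const wirtinger p)"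
proof -
  define L where "L = extremal_factor 2 p 1"
  have L: "L > 0" using extremal_factor_one_pos[of 2 p] p by (simp add: L_def)
  let ?B = "\<lambda>x. best_const wirtinger p (fst x) (snd x)"
  let ?C = "\<lambda>x. C_const p (fst x) (snd x)"
  have C: "(?C \<longlongrightarrow> L) (nhds (0, 0))" using C_const_tendsto[OF p] by (simp add: L_def)
  have le: "eventually (\<lambda>x. ?B x \<le> ?C x) (nhds (0, 0))"
  proof -
    have "eventually (\<lambda>x. x \<in> nhd0) (nhds (0, 0))" using nhd0 by (intro eventually_nhds_in_open)
    thus ?thesis by eventually_elim (rule best_const_le_C_const[OF nhd0_Re(3) p])
  qed
  have B: "(?B \<longlongrightarrow> L) (nhds (0, 0))"
  proof (rule order_tendstoI)
    fix a assume "a < L"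
    thus "eventually (\<lambda>x. a < ?B x) (nhds (0, 0))" using best_const_eventually_gt[OF p] by (simp add: L_def)
  next
    fix a assume "L < a"
    with C have "eventually (\<lambda>x. ?C x < a) (nhds (0, 0))" by (intro order_tendstoD)
    with le show "eventually (\<lambda>x. ?B x < a) (nhds (0, 0))" by eventually_elim simp
  qed
  \<comment> \<open>The filter \<open>nhds\<close> includes the point itself, so a limit along it
    fixes the value there: otherwise a neighbourhood of \<open>L\<close> would exclude that
    value.\<close>
  have "?B (0, 0) = L"
  proof (rule ccontr)
    assume "?B (0, 0) \<noteq> L"
    hence "eventually (\<lambda>y. y \<noteq> ?B (0, 0)) (nhds L)" by (intro t1_space_nhds) auto
    hence "eventually (\<lambda>x. ?B x \<noteq> ?B (0, 0)) (nhds (0, 0))" using B filterlim_iff by fast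
    thus False using eventually_nhds_x_imp_x by fastforce
  qed
  moreover have "((\<lambda>x. ?C x / ?B x) \<longlongrightarrow> L / L) (nhds (0, 0))"
    using C B L by (intro tendsto_divide) auto
  ultimately show ?thesis
    using C L by (simp add: asymptotically_sharp_def case_prod_unfold)
qed

text \<open>The map (\<alpha>, \<beta>) -> (cnj \<beta>, cnj \<alpha>) is continuous and fixes the
  origin, so both limits transfer from the z-derivative.\<close>

lemma D_const_asymptotically_sharp:
  assumes p: "p \<ge> 1"
  shows "asymptotically_sharp (D_const p) (best_const wirtinger_bar p)"
proof -
  let ?\<sigma> = "\<lambda>x. (cnj (snd x), cnj (fst x))"
  have "isCont ?\<sigma> (0, 0)" by (intro continuous_intros)
  from isCont_tendsto_nhds[OF this] have \<sigma>: "filterlim ?\<sigma> (nhds (0, 0)) (nhds (0, 0))" by simp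
  note C = C_const_asymptotically_sharp[OF p, unfolded asymptotically_sharp_def case_prod_unfold]
  show ?thesis
    unfolding asymptotically_sharp_def case_prod_unfold D_eq_C_cnj(1) best_const_wirtinger_bar[OF p]
    using filterlim_compose[OF conjunct1[OF C] \<sigma>] filterlim_compose[OF conjunct2[OF C] \<sigma>] by simp
qed

theorem theorem2:
  fixes \<alpha> \<beta> z :: complex and p r \<theta> :: real and f w :: "complex \<Rightarrow> complex"
  assumes "\<alpha> \<notin> of_int ` {k. k < 0}" and "\<beta> \<notin> of_int ` {k. k < 0}"
    and "Re (\<alpha> + \<beta>) > -1"
    and "1 \<le> p" and "f \<in> Lp_circle p"
    and "\<And>\<zeta>. \<zeta> \<in> ball 0 1 \<Longrightarrow> w \<zeta> = K_int \<alpha> \<beta> f \<zeta>"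
    and "ab_harmonic \<alpha> \<beta> w"
    and "0 \<le> r" and "r < 1" and "z = of_real r * cis \<theta>"
  shows "(cmod (wirtinger w z) \<le> growth_bound p \<alpha> \<beta> f r (C_fun \<alpha> \<beta> p r) \<and>
          growth_bound p \<alpha> \<beta> f r (C_fun \<alpha> \<beta> p r) \<le> growth_bound p \<alpha> \<beta> f r (C_const p \<alpha> \<beta>) \<and>
          asymptotically_sharp (C_const p) (best_const wirtinger p)) \<and>
         (cmod (wirtinger_bar w z) \<le> growth_bound p \<alpha> \<beta> f r (D_fun \<alpha> \<beta> p r) \<and>
          growth_bound p \<alpha> \<beta> f r (D_fun \<alpha> \<beta> p r) \<le> growth_bound p \<alpha> \<beta> f r (D_const p \<alpha> \<beta>) \<and>
          asymptotically_sharp (D_const p) (best_const wirtinger_bar p))"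
proof -
  note p = \<open>1 \<le> p\<close> and f = \<open>f \<in> Lp_circle p\<close>
  have norm_z: "norm z = r" using assms(8,10) by (simp add: norm_mult)
  hence z: "norm z < 1" using assms(9) by simp
  have w: "wirtinger w z = wirtinger (K_int \<alpha> \<beta> f) z" "wirtinger_bar w z = wirtinger_bar (K_int \<alpha> \<beta> f) z"
    by (rule wirtinger_cong; fact assms(6) z)+
  have ab': "Re (cnj \<beta> + cnj \<alpha>) > -1" using assms(3) by simp
  have "cmod (wirtinger w z) \<le> growth_bound p \<alpha> \<beta> f r (C_fun \<alpha> \<beta> p r)"
    using wirtinger_bound[OF f p z assms(3)] by (simp add: w norm_z)
  moreover have "cmod (wirtinger_bar w z) \<le> growth_bound p \<alpha> \<beta> f r (D_fun \<alpha> \<beta> p r)"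
    using wirtinger_bound[OF _ p z ab', of "cnj \<circ> f"] f wirtinger_bar_K_int[OF f p z, of \<alpha> \<beta>]
    by (simp add: w norm_z cnj_Lp_circle_iff growth_bound_cnj D_eq_C_cnj)
  moreover have "growth_bound p \<alpha> \<beta> f r (C_fun \<alpha> \<beta> p r) \<le> growth_bound p \<alpha> \<beta> f r (C_const p \<alpha> \<beta>)"
    by (intro growth_bound_mono C_fun_le_C_const assms)
  moreover have "growth_bound p \<alpha> \<beta> f r (D_fun \<alpha> \<beta> p r) \<le> growth_bound p \<alpha> \<beta> f r (D_const p \<alpha> \<beta>)"
    unfolding D_eq_C_cnj by (intro growth_bound_mono C_fun_le_C_const assms ab')
  ultimately show ?thesis
    using C_const_asymptotically_sharp[OF p] D_const_asymptotically_sharp[OF p] by blast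
qed

end
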